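(* Let $\Phi:\Delta\to\mathbb{R}^{n\times n}$, where $\Delta=\{(t,\tau)\in\mathbb{R}\times\mathbb{R}: t\ge\tau\}$, be measurable and locally essentially bounded on $\Delta$, and let the measurable functions $f,\tilde f:\mathbb{R}\times\mathbb{R}^n\to\mathbb{R}^n$ satisfy the Filippov Condition. Then for any $x^0\in\mathbb{R}^n$ and any $t^0\in\mathbb{R}$ the initial value problem $$\dot x(t)=f(t,x(t))+\int_{t^0}^t\Phi(t,\tau)\tilde f(\tau,x(\tau))\,d\tau,\quad t>t^0,\qquad x(t^0)=x^0,$$ has a Filippov solution defined, at least, locally in the forward time (i.e., on some interval $[t^0,t^0+\alpha)$ with $\alpha>0$).
   Context: $\|\cdot\|$ is the Euclidean norm and $\mathcal{B}(r)\subset\mathbb{R}^n$ is the open ball of radius $r>0$ centered at $0$. A function is locally essentially bounded on a set if its norm has finite essential supremum over every compact subset of that set. Filippov Condition: $g:\mathbb{R}\times\mathbb{R}^n\to\mathbb{R}^n$ is measurable and for any $\alpha,r>0$ there exists $m\in L^1((-\alpha,\alpha);\mathbb{R})$ such that $\|g(t,x)\|\le m(t)$ for almost all $t\in(-\alpha,\alpha)$ and almost all $x\in\mathcal{B}(r)$. Filippov regularization: $K[g](t,x)=\bigcap_{\delta>0}\bigcap_{\mu(M)=0}\overline{\mathrm{co}}\,g(t,x+\mathcal{B}(\delta)\setminus M)$, where $\overline{\mathrm{co}}$ is the convex closure and the intersections are over all $\delta>0$ and all $M\subset\mathbb{R}^n$ of Lebesgue measure zero. Filippov solution of the integro-differential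 IVP on $\mathcal{I}=[t^0,t^0+\alpha)$ (with $\alpha>0$) or $\mathcal{I}=[t^0,+\infty)$: an absolutely continuous function $x:\mathcal{I}\to\mathbb{R}^n$ with $x(t^0)=x^0$ such that, for almost all $t\in\mathcal{I}$, $$\dot x(t)\in K[f](t,x(t))+\int_{t^0}^t\Phi(t,\tau)K[\tilde f](\tau,x(\tau))\,d\tau,$$ where the integral of the set-valued function is understood in the sense of Aumann (the set of integrals of all integrable selections). *)

theory Defs
  imports "HOL-Analysis.Analysis" "HOL-Probability.Essential_Supremum"
begin

(* On square matrices norm is the Frobenius norm; replacing it by an operator norm would not
   change the notion. *)
definition locally_ess_bounded_on ::
    "'a::euclidean_space set \<Rightarrow> ('a \<Rightarrow> 'b::real_normed_vector) \<Rightarrow> bool" where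
  "locally_ess_bounded_on D g \<longleftrightarrow>
     (\<forall>C. compact C \<and> C \<subseteq> D \<longrightarrow> esssup (lebesgue_on C) (\<lambda>z. ereal (norm (g z))) < \<infinity>)"

definition Delta :: "(real \<times> real) set" where
  "Delta = {(t, \<tau>). t \<ge> \<tau>}"

definition filippov_condition :: "(real \<times> (real^'n) \<Rightarrow> real^'n) \<Rightarrow> bool" where
  "filippov_condition g \<longleftrightarrow>
     g \<in> borel_measurable lebesgue \<and>
     (\<forall>\<alpha>>0. \<forall>r>0. \<exists>m :: real \<Rightarrow> real.
        set_integrable lebesgue {-\<alpha><..<\<alpha>} m \<and>
        (AE t in lebesgue. t \<in> {-\<alpha><..<\<alpha>} \<longrightarrow>
          (AE x in lebesgue. x \<in> ball 0 r \<longrightarrow> norm (g (t, x)) \<le> m t)))"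

(* ball x \<delta> is the translate of the ball of radius \<delta> centred at the origin. *)
definition filippov_reg :: "(real \<times> (real^'n) \<Rightarrow> real^'n) \<Rightarrow> real \<Rightarrow> real^'n \<Rightarrow> (real^'n) set" where
  "filippov_reg g t x =
     (\<Inter>\<delta>\<in>{0<..}. \<Inter>M\<in>null_sets lebesgue.
        closure (convex hull ((\<lambda>y. g (t, y)) ` (ball x \<delta> - M))))"

(* Selections are required to lie in F only almost everywhere: the Filippov regularization may be
   empty on a null set of times, where no selection exists. *)
definition aumann_integral ::
    "real \<Rightarrow> real \<Rightarrow> (real \<Rightarrow> 'b::euclidean_space set) \<Rightarrow> 'b set" where
  "aumann_integral a b F =
     {set_lebesgue_integral lebesgue {a..b} w | w.
        set_integrable lebesgue {a..b} w \<and>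
        (AE \<tau> in lebesgue. \<tau> \<in> {a..b} \<longrightarrow> w \<tau> \<in> F \<tau>)}"

(* Absolute continuity of a function; the library constant absolutely_continuous is the
   corresponding relation between measures. *)
definition abs_continuous_on :: "real set \<Rightarrow> (real \<Rightarrow> 'b::real_normed_vector) \<Rightarrow> bool" where
  "abs_continuous_on I x \<longleftrightarrow>
     (\<forall>\<epsilon>>0. \<exists>\<delta>>0. \<forall>D :: (real \<times> real) set.
        finite D \<and> (\<forall>(a, b)\<in>D. a \<le> b \<and> {a..b} \<subseteq> I) \<and>
        disjoint_family_on (\<lambda>(a, b). {a<..<b}) D \<and> (\<Sum>(a, b)\<in>D. b - a) < \<delta>
        \<longrightarrow> (\<Sum>(a, b)\<in>D. norm (x b - x a)) < \<epsilon>)"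

(* The sum of sets below is the Minkowski sum. *)
definition filippov_solution ::
    "(real \<times> real \<Rightarrow> real^'n^'n) \<Rightarrow> (real \<times> (real^'n) \<Rightarrow> real^'n) \<Rightarrow> (real \<times> (real^'n) \<Rightarrow> real^'n) \<Rightarrow>
     real \<Rightarrow> real^'n \<Rightarrow> real set \<Rightarrow> (real \<Rightarrow> real^'n) \<Rightarrow> bool" where
  "filippov_solution \<Phi> f f' t0 x0 I x \<longleftrightarrow>
     abs_continuous_on I x \<and> x t0 = x0 \<and>
     (AE t in lebesgue. t \<in> I \<longrightarrow>
        (\<exists>v. (x has_vector_derivative v) (at t within I) \<and>
             v \<in> filippov_reg f t (x t) +
                 aumann_integral t0 t (\<lambda>\<tau>. (\<lambda>u. \<Phi> (t, \<tau>) *v u) ` filippov_reg f' \<tau> (x \<tau>))))"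

end

theory Submission
  imports Defs "HOL-Complex_Analysis.Great_Picard"
begin

text \<open>
The proof constructs solutions of equations that are both regularized and delayed, and passes to
the limit by averaging instead of by weak compactness.

First the data are tamed. A Filippov regularization sees a function only up to null sets and only
near the current point, so \<open>f\<close> and \<open>f'\<close> may be replaced by Borel functions \<open>F\<close> and \<open>G\<close> that are
bounded by one integrable function of time everywhere, and \<open>\<Phi>\<close> by a bounded Borel kernel that lives
on a triangle (\<open>filippov_condition_truncation\<close>, \<open>kernel_truncation\<close>). As long as the solution stays in
the ball on which the bounds were taken, for almost every time a value of the regularization of \<open>F\<close>
or \<open>G\<close> is a value of the regularization of \<open>f\<close> or \<open>f'\<close>. For the tamed data there is a solution on
every bounded time interval, and only this restriction to the ball makes the final result local.

With \<open>H = (F, G)\<close> the equation reads \<open>x' = S h\<close>, where \<open>h\<close> selects from the regularization of \<open>H\<close> along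
\<open>x\<close> and \<open>S h s\<close> is the first component of \<open>h s\<close> plus the memory integral of the second one. All
that matters about \<open>S\<close> is that it is affine, causal, bounded and continuous under dominated
convergence; this is the locale \<open>volterra_operator\<close>. Its existence result \<open>inclusion_solution\<close> rests
on three ideas.

\<^item> Replace \<open>H (s, \<cdot>)\<close> by its average over the ball of radius \<open>\<epsilon>\<close> about \<open>x (s - \<epsilon>)\<close>. Because of the
  delay, this equation is solved by finitely many explicit integrations (\<open>delayed_solution\<close>). By
  Hahn-Banach separation an average lies in every closed convex set that contains almost all the
  averaged values (\<open>average_in_closed_convex\<close>), so it is an admissible value of the inclusion up to an
  error in the base point.

\<^item> The approximate solutions share one modulus of continuity, hence by Arzela-Ascoli a subsequence
  converges uniformly.

\<^item> Their right-hand sides need not converge, but suitable convex combinations of their tails do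
  converge almost everywhere (\<open>dominated_tail_midpoints_converge\<close>). As \<open>S\<close> respects convex
  combinations, the same combinations of the approximate solutions still tend to the uniform limit,
  and as the values of the regularization are closed and convex, the limit of the combinations is
  still a selection.

The limit is a primitive of an integrable function. It is therefore absolutely continuous, and by
the Lebesgue differentiation theorem it satisfies the inclusion at almost every time.
\<close>

section \<open>Essential convex hulls and ball averages\<close>

text \<open>
A hyperplane that strictly separates the average from \<open>C\<close> would separate it from almost all the
values, hence from their average, which is itself.
\<close>

lemma average_in_closed_convex:
  fixes g :: "'c \<Rightarrow> 'b::euclidean_space"
  assumes B: "B \<in> sets M" "0 < measure M B"
    and g: "set_integrable M B g"
    and C: "closed C" "convex C" and in_C: "AE z in M. z \<in> B \<longrightarrow> g z \<in> C"
  shows "(LINT z:B|M. g z) /\<^sub>R measure M B \<in> C"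
proof (rule ccontr)
  let ?\<mu> = "measure M B" and ?I = "LINT z:B|M. g z"
  assume "?I /\<^sub>R ?\<mu> \<notin> C"
  then obtain a b where ab: "a \<bullet> (?I /\<^sub>R ?\<mu>) < b" "\<And>c. c \<in> C \<Longrightarrow> b < a \<bullet> c"
    using separating_hyperplane_closed_point[OF C(2,1)] by blast
  have fin: "emeasure M B < \<infinity>"
    using B(2) by (auto simp: measure_def less_top enn2real_positive_iff)
  have "?\<mu> * b = (LINT z:B|M. b)"
    using B fin by (simp add: set_integral_const)
  also have "\<dots> \<le> (LINT z:B|M. a \<bullet> g z)"
  proof (rule set_integral_mono_AE)
    show "set_integrable M B (\<lambda>z. b)"
      using B fin unfolding set_integrable_def by (intro integrable_scaleR_left integrable_indicator) auto
    show "set_integrable M B (\<lambda>z. a \<bullet> g z)"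
      using integrable_inner_right[of a, OF g[unfolded set_integrable_def]] by (simp add: set_integrable_def)
    show "AE z \<in> B in M. b \<le> a \<bullet> g z"
      using in_C by eventually_elim (auto intro: less_imp_le ab(2))
  qed
  also have "\<dots> = a \<bullet> ?I"
    using integral_inner_right[of a, OF g[unfolded set_integrable_def]] by (simp add: set_lebesgue_integral_def)
  also have "\<dots> = ?\<mu> * (a \<bullet> (?I /\<^sub>R ?\<mu>))"
    using B by (simp add: field_simps)
  also have "\<dots> < ?\<mu> * b"
    using ab(1) B(2) by simp
  finally show False by simp
qed


text \<open>
The set that remains of the Filippov regularization when the radius \<open>\<delta>\<close> is kept fixed; \<open>U\<close> plays the
role of the ball. It does not change when \<open>G\<close> changes on a null set.
\<close>

definition ess_hull :: "('a::euclidean_space \<Rightarrow> 'b::euclidean_space) \<Rightarrow> 'a set \<Rightarrow> 'b set" where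
  "ess_hull G U = (\<Inter>N\<in>null_sets lebesgue. closure (convex hull (G ` (U - N))))"

lemma filippov_reg_eq_ess_hull:
  "filippov_reg g t x = (\<Inter>\<delta>\<in>{0<..}. ess_hull (\<lambda>y. g (t, y)) (ball x \<delta>))"
  unfolding filippov_reg_def ess_hull_def ..

lemma closed_ess_hull: "closed (ess_hull G U)"
  unfolding ess_hull_def by auto

lemma convex_ess_hull: "convex (ess_hull G U)"
  unfolding ess_hull_def by (auto intro!: convex_INT)

lemma ess_hull_mono: "U \<subseteq> V \<Longrightarrow> ess_hull G U \<subseteq> ess_hull G V"
  unfolding ess_hull_def by (intro INT_anti_mono INF_mono' closure_mono hull_mono image_mono) auto

lemma ess_hull_subset_AE:
  assumes "AE y in lebesgue. y \<in> U \<longrightarrow> G y = G' y"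
  shows "ess_hull G U \<subseteq> ess_hull G' U"
proof -
  obtain N where N: "N \<in> null_sets lebesgue" "{y. \<not> (y \<in> U \<longrightarrow> G y = G' y)} \<subseteq> N"
    using assms unfolding eventually_ae_filter by auto
  show ?thesis
    unfolding ess_hull_def
  proof (rule INF_greatest)
    fix M :: "'a set" assume "M \<in> null_sets lebesgue"
    then have "M \<union> N \<in> null_sets lebesgue" using N by auto
    moreover have "G ` (U - (M \<union> N)) \<subseteq> G' ` (U - M)"
      using N(2) by (force simp: image_iff)
    ultimately show "(\<Inter>N\<in>null_sets lebesgue. closure (convex hull (G ` (U - N)))) \<subseteq> closure (convex hull (G' ` (U - M)))"
      by (intro INF_lower2[of "M \<union> N"] closure_mono hull_mono)
  qed
qed

text \<open>
Applied to the two projections, this recovers the regularizations of \<open>F\<close> and \<open>G\<close> from the one of the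
pair \<open>(F, G)\<close>. The pair has to be treated as one function so that the same convex combinations serve
both components.
\<close>

lemma bounded_linear_image_ess_hull:
  assumes "bounded_linear L"
  shows "L ` ess_hull G U \<subseteq> ess_hull (\<lambda>y. L (G y)) U"
proof -
  have "L ` closure (convex hull (G ` X)) \<subseteq> closure (convex hull ((\<lambda>y. L (G y)) ` X))" for X
    using closure_bounded_linear_image_subset[OF assms, of "convex hull (G ` X)"]
      convex_hull_linear_image[OF bounded_linear.linear[OF assms], of "G ` X"]
    by (simp add: image_image)
  then show ?thesis
    unfolding ess_hull_def by blast
qed

definition ball_average :: "real \<Rightarrow> ('a::euclidean_space \<Rightarrow> 'b::euclidean_space) \<Rightarrow> 'a \<Rightarrow> 'b" where
  "ball_average \<rho> G y = (LINT z:ball 0 \<rho>|lborel. G (y + z)) /\<^sub>R measure lborel (ball (0::'a) \<rho>)"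

lemma measure_ball_0_pos: "0 < \<rho> \<Longrightarrow> 0 < measure lborel (ball (0::'a::euclidean_space) \<rho>)"
  by (simp add: content_ball_pos)

lemma ball_average_measurable [measurable (raw)]:
  fixes H :: "real \<times> 'a::euclidean_space \<Rightarrow> 'b::euclidean_space"
  assumes H: "H \<in> borel_measurable borel" and [measurable]: "Y \<in> borel_measurable borel"
  shows "(\<lambda>s. ball_average \<rho> (\<lambda>y. H (s, y)) (Y s)) \<in> borel_measurable borel"
proof -
  have [measurable]: "H \<in> borel_measurable (borel \<Otimes>\<^sub>M borel)"
    using H by (simp add: borel_prod)
  have [measurable]: "ball (0::'a) \<rho> \<in> sets borel" by simp
  show ?thesis
    unfolding ball_average_def set_lebesgue_integral_def by measurable
qed

lemma norm_ball_average_le: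
  fixes G :: "'a::euclidean_space \<Rightarrow> 'b::euclidean_space"
  assumes "0 < \<rho>" "\<And>y. norm (G y) \<le> c"
  shows "norm (ball_average \<rho> G y) \<le> c"
proof -
  let ?B = "ball (0::'a) \<rho>"
  have c: "0 \<le> c" using assms(2)[of undefined] norm_ge_zero order_trans by blast
  have "norm (LINT z:?B|lborel. G (y + z)) \<le> (LINT z|lborel. indicat_real ?B z * c)"
    unfolding set_lebesgue_integral_def
  proof (rule order_trans[OF integral_norm_bound], rule integral_mono')
    show "integrable lborel (\<lambda>z. indicat_real ?B z * c)"
      by (intro integrable_mult_left integrable_real_indicator emeasure_lborel_ball_finite) auto
  qed (auto simp: indicator_def assms c)
  also have "\<dots> = measure lborel ?B * c" by simp
  finally show ?thesis
    using measure_ball_0_pos[OF assms(1), where 'a='a] by (simp add: ball_average_def field_simps)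
qed

lemma ball_average_in_ess_hull:
  fixes G :: "'a::euclidean_space \<Rightarrow> 'b::euclidean_space"
  assumes [measurable]: "G \<in> borel_measurable borel" and "\<And>y. norm (G y) \<le> c" and \<rho>: "0 < \<rho>"
  shows "ball_average \<rho> G y \<in> ess_hull G (ball y \<rho>)"
  unfolding ess_hull_def
proof
  fix N :: "'a set" assume N: "N \<in> null_sets lebesgue"
  let ?B = "ball (0::'a) \<rho>"
  show "ball_average \<rho> G y \<in> closure (convex hull (G ` (ball y \<rho> - N)))"
    unfolding ball_average_def
  proof (rule average_in_closed_convex)
    show "set_integrable lborel ?B (\<lambda>z. G (y + z))"
      unfolding set_integrable_def
    proof (rule Bochner_Integration.integrable_bound)
      show "integrable lborel (\<lambda>z. indicat_real ?B z * c)"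
        by (intro integrable_mult_left integrable_real_indicator emeasure_lborel_ball_finite) auto
      show "AE z in lborel. norm (indicat_real ?B z *\<^sub>R G (y + z)) \<le> norm (indicat_real ?B z * c)"
        using assms(2) by (auto simp: indicator_def intro: order_trans[OF _ abs_ge_self])
      have "(\<lambda>z. G (y + z)) \<in> borel_measurable borel" by measurable
      then show "(\<lambda>z. indicat_real ?B z *\<^sub>R G (y + z)) \<in> borel_measurable lborel"
        by (intro borel_measurable_scaleR borel_measurable_indicator) auto
    qed
    have "(+) (- y) ` N \<in> null_sets lebesgue"
      using N by (metis negligible_iff_null_sets negligible_translation)
    then have "AE z in lebesgue. z \<notin> (+) (- y) ` N" by (rule AE_not_in)
    then have "AE z in lebesgue. z \<in> ?B \<longrightarrow> G (y + z) \<in> closure (convex hull (G ` (ball y \<rho> - N)))"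
    proof eventually_elim
      case (elim z)
      show ?case
      proof
        assume "z \<in> ?B"
        moreover have "y + z \<notin> N" using elim by force
        ultimately have "G (y + z) \<in> G ` (ball y \<rho> - N)"
          by (auto simp: dist_norm)
        then show "G (y + z) \<in> closure (convex hull (G ` (ball y \<rho> - N)))"
          by (meson closure_subset hull_inc subsetD)
      qed
    qed
    then show "AE z in lborel. z \<in> ?B \<longrightarrow> G (y + z) \<in> closure (convex hull (G ` (ball y \<rho> - N)))"
      by (simp add: AE_completion_iff)
  qed (use measure_ball_0_pos[OF \<rho>] in auto)
qed


section \<open>Indefinite integrals\<close>

lemma set_integral_lborel_eq_integral:
  fixes w :: "real \<Rightarrow> 'b::euclidean_space"
  assumes "integrable lborel w"
  shows "w integrable_on {a..b}" "(LINT s:{a..b}|lborel. w s) = integral {a..b} w"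
proof -
  have "set_integrable lborel {a..b} w"
    unfolding set_integrable_def by (intro integrable_mult_indicator assms) auto
  then show "w integrable_on {a..b}" "(LINT s:{a..b}|lborel. w s) = integral {a..b} w"
    by (auto dest: set_borel_integral_eq_integral)
qed

text \<open>
One half of the Lebesgue differentiation theorem on the line; the left derivative follows from it by
reflection in \<open>AE_indefinite_integral_has_derivative\<close>.
\<close>

lemma AE_indefinite_integral_right_derivative:
  fixes w :: "real \<Rightarrow> 'b::euclidean_space"
  assumes w: "integrable lborel w"
  shows "AE t in lebesgue. ((\<lambda>h. integral {t..t+h} w /\<^sub>R h) \<longlongrightarrow> w t) (at_right 0)"
proof -
  have "w integrable_on cbox a b" for a b
    using set_integral_lborel_eq_integral(1)[OF w] by simp
  then obtain N where N: "negligible N" and *: "\<And>x e. \<lbrakk>x \<notin> N; 0 < e\<rbrakk> \<Longrightarrow>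
      \<exists>d>0. \<forall>h. 0 < h \<and> h < d \<longrightarrow> norm (integral (cbox x (x + h *\<^sub>R One)) w /\<^sub>R h ^ DIM(real) - w x) < e"
    by (rule integrable_ccontinuous_explicit[of w]) blast
  have "((\<lambda>h. integral {t..t+h} w /\<^sub>R h) \<longlongrightarrow> w t) (at_right 0)" if "t \<notin> N" for t
  proof (rule tendstoI)
    fix e :: real assume "e > 0"
    from *[OF that this] obtain d where "d > 0" and
      d: "\<And>h. 0 < h \<and> h < d \<Longrightarrow> norm (integral {t..t+h} w /\<^sub>R h - w t) < e"
      by auto
    then show "\<forall>\<^sub>F h in at_right 0. dist (integral {t..t+h} w /\<^sub>R h) (w t) < e"
      unfolding eventually_at_right_field dist_norm by (intro exI[of _ d]) auto
  qed
  moreover have "AE t in lebesgue. t \<notin> N"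
    using N by (simp add: negligible_iff_null_sets AE_not_in)
  ultimately show ?thesis by auto
qed

lemma AE_lborel_reflect:
  assumes "AE t in lebesgue. P (t::real)"
  shows "AE t in lebesgue. P (- t)"
proof -
  obtain N where N: "N \<in> null_sets lebesgue" "{t. \<not> P t} \<subseteq> N"
    using assms unfolding eventually_ae_filter by auto
  have "negligible ((\<lambda>t. -t) ` N)"
    using N(1) by (intro negligible_differentiable_image_negligible)
      (auto simp: negligible_iff_null_sets intro!: derivative_intros)
  then have "(\<lambda>t. -t) ` N \<in> null_sets lebesgue"
    by (simp add: negligible_iff_null_sets)
  then show ?thesis
    by (rule AE_I') (use N(2) in force)
qed

lemma AE_indefinite_integral_has_derivative:
  fixes w :: "real \<Rightarrow> 'b::euclidean_space"
  assumes w: "integrable lborel w"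
  shows "AE t in lebesgue. a < t \<longrightarrow> ((\<lambda>t. LINT s:{a..t}|lborel. w s) has_vector_derivative w t) (at t)"
proof -
  let ?v = "\<lambda>s. w (- s)"
  have v: "integrable lborel ?v"
    using lborel_integrable_real_affine[OF w, of "-1" 0] by simp
  have int: "w integrable_on {c..d}" for c d
    using set_integral_lborel_eq_integral(1)[OF w] .
  have left: "AE t in lebesgue. ((\<lambda>h. integral {- t..-t+h} ?v /\<^sub>R h) \<longlongrightarrow> w t) (at_right 0)"
    using AE_lborel_reflect[OF AE_indefinite_integral_right_derivative[OF v]] by simp
  show ?thesis
    using AE_indefinite_integral_right_derivative[OF w] left
  proof eventually_elim
    case (elim t)
    show ?case
    proof
      assume "a < t"
      let ?F = "\<lambda>t. integral {a..t} w"
      have 1: "((\<lambda>h. (?F (t + h) - ?F t) /\<^sub>R h) \<longlongrightarrow> w t) (at_right 0)"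
      proof (rule Lim_transform_eventually[OF elim(1)])
        have eq: "integral {t..t + h} w = ?F (t + h) - ?F t" if "0 < h" for h
        proof -
          have "?F t + integral {t..t + h} w = ?F (t + h)"
            using int that \<open>a < t\<close> by (intro Henstock_Kurzweil_Integration.integral_combine) auto
          then show ?thesis by (metis add_diff_cancel_left')
        qed
        show "\<forall>\<^sub>F h in at_right 0. integral {t..t + h} w /\<^sub>R h = (?F (t + h) - ?F t) /\<^sub>R h"
          unfolding eventually_at_right_field by (intro exI[of _ 1]) (auto simp: eq)
      qed
      have "((\<lambda>h. (?F (t - h) - ?F t) /\<^sub>R (- h)) \<longlongrightarrow> w t) (at_right 0)"
      proof (rule Lim_transform_eventually[OF elim(2)])
        have eq: "integral {- t..- t + h} ?v = ?F t - ?F (t - h)" if "0 < h" "h < t - a" for h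
        proof -
          have "integral {- t..- t + h} ?v = integral {t - h..t} w"
            using Henstock_Kurzweil_Integration.integral_reflect_real[of "t" "t-h" w]
            by (simp only: minus_diff_eq) (simp only: add.commute diff_conv_add_uminus)
          moreover have "?F (t - h) + integral {t - h..t} w = ?F t"
            using int that by (intro Henstock_Kurzweil_Integration.integral_combine) auto
          ultimately show ?thesis by (metis add_diff_cancel_left')
        qed
        show "\<forall>\<^sub>F h in at_right 0. integral {- t..- t + h} ?v /\<^sub>R h = (?F (t - h) - ?F t) /\<^sub>R (- h)"
          unfolding eventually_at_right_field using \<open>a < t\<close>
          by (intro exI[of _ "t - a"]) (auto simp: eq[simplified] scaleR_diff_right)
      qed
      then have 2: "((\<lambda>h. (?F (t + h) - ?F t) /\<^sub>R h) \<longlongrightarrow> w t) (at_left 0)"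
        by (simp add: filterlim_at_left_to_right)
      from 1 2 have "((\<lambda>h. (?F (t + h) - ?F t) /\<^sub>R h) \<longlongrightarrow> w t) (at 0)"
        by (simp add: filterlim_split_at)
      then have "((\<lambda>h. norm ((?F (t + h) - ?F t) /\<^sub>R h - w t)) \<longlongrightarrow> 0) (at 0)"
        by (simp add: tendsto_norm_zero_iff LIM_zero)
      then have "((\<lambda>h. norm (?F (t + h) - ?F t - h *\<^sub>R w t) / norm h) \<longlongrightarrow> 0) (at 0)"
      proof (rule Lim_transform_eventually)
        have "norm ((?F (t + h) - ?F t) /\<^sub>R h - w t) = norm (?F (t + h) - ?F t - h *\<^sub>R w t) / norm h"
          if "h \<noteq> 0" for h
        proof -
          have "(?F (t + h) - ?F t) /\<^sub>R h - w t = (?F (t + h) - ?F t - h *\<^sub>R w t) /\<^sub>R h"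
            using that by (simp add: scaleR_diff_right)
          then show ?thesis by (simp add: divide_inverse_commute)
        qed
        then show "\<forall>\<^sub>F h in at 0. norm ((?F (t + h) - ?F t) /\<^sub>R h - w t) =
            norm (?F (t + h) - ?F t - h *\<^sub>R w t) / norm h"
          by (auto simp: eventually_at_filter)
      qed
      then have "(?F has_vector_derivative w t) (at t)"
        by (simp add: has_vector_derivative_def has_derivative_at bounded_linear_scaleR_left)
      then show "((\<lambda>t. LINT s:{a..t}|lborel. w s) has_vector_derivative w t) (at t)"
        by (simp add: set_integral_lborel_eq_integral(2)[OF w])
    qed
  qed
qed

definition primitive_from :: "real \<Rightarrow> 'a \<Rightarrow> (real \<Rightarrow> 'a::euclidean_space) \<Rightarrow> real \<Rightarrow> 'a" where
  "primitive_from a c w t = c + (LINT s:{a..t}|lborel. w s)"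

lemma set_integrable_Icc: 
  fixes w :: "real \<Rightarrow> 'b::euclidean_space"
  shows "integrable lborel w \<Longrightarrow> set_integrable lborel {a..b} w"
  unfolding set_integrable_def by (intro integrable_mult_indicator) auto

lemma primitive_from_initial:
  assumes "integrable lborel w" "t \<le> a" shows "primitive_from a c w t = c"
  using assms set_integral_lborel_eq_integral(2)[OF assms(1), of a a]
  by (cases "t = a") (auto simp: primitive_from_def set_lebesgue_integral_def[of _ "{}"])

lemma primitive_from_measurable [measurable (raw)]:
  assumes [measurable]: "w \<in> borel_measurable borel"
  shows "primitive_from a c w \<in> borel_measurable borel"
proof -
  have "primitive_from a c w = (\<lambda>t. c + (LINT s|lborel. (if a \<le> s \<and> s \<le> t then w s else 0)))"
    unfolding primitive_from_def set_lebesgue_integral_def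
    by (intro ext arg_cong[where f = "(+) c"] Bochner_Integration.integral_cong) (auto simp: indicator_def)
  then show ?thesis by simp
qed

lemma primitive_from_cong:
  assumes "\<And>s. s \<le> t \<Longrightarrow> w s = w' s"
  shows "primitive_from a c w t = primitive_from a c w' t"
  unfolding primitive_from_def by (auto intro!: set_lebesgue_integral_cong assms)

lemma continuous_on_primitive_from:
  assumes "integrable lborel w"
  shows "continuous_on {a..b} (primitive_from a c w)"
  unfolding primitive_from_def
  by (auto simp: set_integral_lborel_eq_integral[OF assms] intro!: continuous_intros indefinite_integral_continuous_1
      set_integral_lborel_eq_integral(1)[OF assms])

text \<open>
The modulus of continuity on the right depends on \<open>W\<close> only, which makes the primitives of all
functions dominated by \<open>W\<close> equicontinuous. Stating it by means of a primitive of \<open>W\<close> covers the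
times before \<open>a\<close>, where primitives are constant, without a case distinction.
\<close>

lemma norm_primitive_from_diff_le:
  fixes w :: "real \<Rightarrow> 'a::euclidean_space"
  assumes w: "integrable lborel w" and W: "integrable lborel W" and le: "\<And>s. norm (w s) \<le> W s" and "t \<le> t'"
  shows "norm (primitive_from a c w t' - primitive_from a c w t) \<le> primitive_from a 0 W t' - primitive_from a 0 W t"
proof -
  let ?i = "\<lambda>s. indicator {a..t'} s - indicator {a..t} s :: real"
  have i: "0 \<le> ?i s" for s using \<open>t \<le> t'\<close> by (auto simp: indicator_def)
  have wi: "integrable lborel (\<lambda>s. indicat_real {a..b} s *\<^sub>R w s)" 
    and Wi: "integrable lborel (\<lambda>s. indicat_real {a..b} s *\<^sub>R W s)" for b
    using set_integrable_Icc[OF w] set_integrable_Icc[OF W] by (auto simp: set_integrable_def)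
  have "primitive_from a c w t' - primitive_from a c w t = (LINT s|lborel. ?i s *\<^sub>R w s)"
    using wi by (simp add: primitive_from_def set_lebesgue_integral_def scaleR_diff_left)
  also have "norm \<dots> \<le> (LINT s|lborel. ?i s *\<^sub>R W s)"
  proof (rule order_trans[OF integral_norm_bound], rule integral_mono)
    show "integrable lborel (\<lambda>s. norm (?i s *\<^sub>R w s))" "integrable lborel (\<lambda>s. ?i s *\<^sub>R W s)"
      unfolding scaleR_diff_left using wi Wi by auto
    show "norm (?i s *\<^sub>R w s) \<le> ?i s *\<^sub>R W s" for s
      using i[of s] le[of s] by (auto intro: mult_left_mono)
  qed
  also have "\<dots> = primitive_from a 0 W t' - primitive_from a 0 W t"
    using Wi by (simp add: primitive_from_def set_lebesgue_integral_def left_diff_distrib)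
  finally show ?thesis .
qed

lemma norm_primitive_from_le:
  fixes w :: "real \<Rightarrow> 'a::euclidean_space"
  assumes w: "integrable lborel w" and W: "integrable lborel W" and le: "\<And>s. norm (w s) \<le> W s"
  shows "norm (primitive_from a c w t) \<le> norm c + integral\<^sup>L lborel W"
proof -
  have "0 \<le> W s" for s using le[of s] norm_ge_zero order_trans by blast
  then have "norm (LINT s:{a..t}|lborel. w s) \<le> integral\<^sup>L lborel W"
    unfolding set_lebesgue_integral_def
    by (intro order_trans[OF integral_norm_bound] integral_mono') (auto simp: W indicator_def le)
  then show ?thesis
    unfolding primitive_from_def by (intro order_trans[OF norm_triangle_ineq]) simp
qed

lemma primitive_from_midpoint:
  fixes v w :: "real \<Rightarrow> 'a::euclidean_space"
  assumes "integrable lborel v" "integrable lborel w"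
  shows "primitive_from a c (\<lambda>s. midpoint (v s) (w s)) t = midpoint (primitive_from a c v t) (primitive_from a c w t)"
proof -
  have "(LINT s:{a..t}|lborel. midpoint (v s) (w s)) = midpoint (LINT s:{a..t}|lborel. v s) (LINT s:{a..t}|lborel. w s)"
    unfolding midpoint_def using assms by (simp add: set_integral_add set_integrable_Icc)
  then show ?thesis
    by (simp add: primitive_from_def midpoint_def scaleR_right_distrib scaleR_half_double algebra_simps flip: scaleR_add_left)
qed

text \<open>
Split \<open>norm (w s)\<close> at a large level \<open>n\<close>. The part below \<open>n\<close> contributes at most \<open>n\<close> times the total length of
the intervals, the excess over \<open>n\<close> at most its integral over the whole line, which is small by
dominated convergence.
\<close>

lemma abs_continuous_on_primitive_from:
  fixes w :: "real \<Rightarrow> 'a::euclidean_space"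
  assumes w: "integrable lborel w"
  shows "abs_continuous_on I (primitive_from a c w)"
  unfolding abs_continuous_on_def
proof (intro allI impI)
  fix \<epsilon> :: real assume "0 < \<epsilon>"
  let ?W = "\<lambda>s. norm (w s)"
  have [measurable]: "w \<in> borel_measurable borel"
    using borel_measurable_integrable[OF w] by simp
  have W: "integrable lborel ?W" using w by simp
  let ?v = "\<lambda>n s. max 0 (?W s - real n)"
  have v_int: "integrable lborel (?v n)" for n
    by (rule Bochner_Integration.integrable_bound[OF W]) auto
  have "(\<lambda>n. integral\<^sup>L lborel (?v n)) \<longlonglongrightarrow> (LINT s::real|lborel. 0::real)"
  proof (rule integral_dominated_convergence[where w = ?W])
    show "AE s in lborel. (\<lambda>n. ?v n s) \<longlonglongrightarrow> 0"
    proof (rule AE_I2)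
      fix s
      obtain n0 :: nat where "?W s \<le> n0" using real_arch_simple by blast
      then have "\<forall>\<^sub>F n in sequentially. ?v n s = 0"
        unfolding eventually_sequentially by (intro exI[of _ n0]) auto
      then show "(\<lambda>n. ?v n s) \<longlonglongrightarrow> 0" by (rule tendsto_eventually)
    qed
  qed (use W in auto)
  then have "\<forall>\<^sub>F n in sequentially. integral\<^sup>L lborel (?v n) < \<epsilon> / 2"
    using \<open>0 < \<epsilon>\<close> by (intro order_tendstoD(2)) auto
  then obtain n where n: "integral\<^sup>L lborel (?v n) < \<epsilon> / 2"
    by (auto simp: eventually_sequentially)
  have interval: "norm (primitive_from a c w q - primitive_from a c w p) \<le> real n * (q - p) + (LINT s:{p<..<q}|lborel. ?v n s)"
    if "p \<le> q" for p q :: real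
  proof -
    have "norm (primitive_from a c w q - primitive_from a c w p) \<le> primitive_from a 0 ?W q - primitive_from a 0 ?W p"
      using that by (intro norm_primitive_from_diff_le w W) auto
    also have "\<dots> = (LINT s|lborel. (indicator {a..q} s - indicator {a..p} s) * ?W s)"
      using set_integrable_Icc[OF W, of a p] set_integrable_Icc[OF W, of a q]
      by (simp add: primitive_from_def set_lebesgue_integral_def left_diff_distrib set_integrable_def)
    also have "\<dots> \<le> (LINT s|lborel. indicator {p..q} s * ?W s)"
    proof (rule integral_mono)
      show "integrable lborel (\<lambda>s. (indicator {a..q} s - indicator {a..p} s) * ?W s)"
        "integrable lborel (\<lambda>s. indicator {p..q} s * ?W s)"
        using set_integrable_Icc[OF W, of a p] set_integrable_Icc[OF W, of a q] set_integrable_Icc[OF W, of p q]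
        by (simp_all add: left_diff_distrib set_integrable_def)
    qed (auto simp: indicator_def)
    also have "\<dots> \<le> (LINT s|lborel. indicator {p..q} s * real n + indicator {p..q} s * ?v n s)"
    proof (rule integral_mono)
      show "integrable lborel (\<lambda>s. indicator {p..q} s * ?W s)"
        "integrable lborel (\<lambda>s. indicator {p..q} s * real n + indicator {p..q} s * ?v n s)"
        using set_integrable_Icc[OF W, of p q] set_integrable_Icc[OF v_int, of p q n]
        by (auto simp: set_integrable_def emeasure_lborel_Icc_eq)
    qed (auto simp: indicator_def)
    also have "\<dots> = real n * (q - p) + (LINT s:{p..q}|lborel. ?v n s)"
      using that set_integrable_Icc[OF v_int, of p q]
      by (subst Bochner_Integration.integral_add) (auto simp: set_lebesgue_integral_def set_integrable_def)
    also have "(LINT s:{p..q}|lborel. ?v n s) = (LINT s:{p<..<q}|lborel. ?v n s)"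
      by (rule set_integral_discrete_difference[where X = "{p, q}"]) auto
    finally show ?thesis .
  qed
  define \<delta> where "\<delta> = \<epsilon> / (2 * (real n + 1))"
  have "(\<Sum>(p, q)\<in>D. norm (primitive_from a c w q - primitive_from a c w p)) < \<epsilon>"
    if D: "finite D" "\<forall>(p, q)\<in>D. p \<le> q \<and> {p..q} \<subseteq> I" "disjoint_family_on (\<lambda>(p, q). {p<..<q}) D"
      "(\<Sum>(p, q)\<in>D. q - p) < \<delta>" for D :: "(real \<times> real) set"
  proof -
    let ?J = "\<lambda>(p, q). {p<..<q::real}"
    have v_on: "set_integrable lborel (?J i) (?v n)" for i
      unfolding set_integrable_def by (intro integrable_mult_indicator v_int) (auto split: prod.split)
    have "(\<Sum>(p, q)\<in>D. norm (primitive_from a c w q - primitive_from a c w p))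
        \<le> (\<Sum>(p, q)\<in>D. real n * (q - p) + (LINT s:{p<..<q}|lborel. ?v n s))"
      using D(2) by (intro sum_mono) (auto intro: interval)
    also have "\<dots> = real n * (\<Sum>(p, q)\<in>D. q - p) + (\<Sum>i\<in>D. LINT s:?J i|lborel. ?v n s)"
      by (simp add: case_prod_unfold sum.distrib sum_distrib_left)
    also have "(\<Sum>i\<in>D. LINT s:?J i|lborel. ?v n s) = (LINT s:(\<Union>i\<in>D. ?J i)|lborel. ?v n s)"
      using D by (intro set_integral_finite_Union[symmetric] v_on) (auto split: prod.split)
    also have "\<dots> \<le> integral\<^sup>L lborel (?v n)"
      unfolding set_lebesgue_integral_def by (intro integral_mono' v_int) (auto simp: indicator_def)
    also have "real n * (\<Sum>(p, q)\<in>D. q - p) \<le> real n * \<delta>"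
      using D(4) by (intro mult_left_mono) auto
    also have "real n * \<delta> \<le> \<epsilon> / 2"
      using \<open>0 < \<epsilon>\<close> by (simp add: \<delta>_def field_simps)
    finally show ?thesis using n by simp
  qed
  moreover have "0 < \<delta>" using \<open>0 < \<epsilon>\<close> by (simp add: \<delta>_def)
  ultimately show "\<exists>\<delta>>0. \<forall>D. finite D \<and> (\<forall>(p, q)\<in>D. p \<le> q \<and> {p..q} \<subseteq> I) \<and>
      disjoint_family_on (\<lambda>(p, q). {p<..<q}) D \<and> (\<Sum>(p, q)\<in>D. q - p) < \<delta> \<longrightarrow>
      (\<Sum>(p, q)\<in>D. norm (primitive_from a c w q - primitive_from a c w p)) < \<epsilon>"
    by blast
qed

section \<open>Almost everywhere convergent midpoint combinations\<close>

text \<open>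
Closure under midpoints is enough convexity for the minimization below, and it lets the properties of
combinations be proved by induction, without bookkeeping of coefficients.
\<close>

inductive_set midpoint_hull :: "('c \<Rightarrow> 'b::real_vector) set \<Rightarrow> ('c \<Rightarrow> 'b) set" for A where
  base: "f \<in> A \<Longrightarrow> f \<in> midpoint_hull A"
| mid: "f \<in> midpoint_hull A \<Longrightarrow> g \<in> midpoint_hull A \<Longrightarrow> (\<lambda>x. midpoint (f x) (g x)) \<in> midpoint_hull A"

lemma midpoint_hull_mono: 
  assumes "A \<subseteq> B" shows "midpoint_hull A \<subseteq> midpoint_hull B"
proof
  fix f assume "f \<in> midpoint_hull A"
  then show "f \<in> midpoint_hull B"
    by induction (use assms in \<open>auto intro: midpoint_hull.intros\<close>)
qed

lemma midpoint_in_convex: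
  assumes "convex C" "a \<in> C" "b \<in> C" shows "midpoint a b \<in> C"
  using convexD[OF assms, of "1/2" "1/2"] by (simp add: midpoint_def scaleR_right_distrib)

lemma midpoint_hull_in_convex:
  assumes "g \<in> midpoint_hull A" "convex C" "\<And>f. f \<in> A \<Longrightarrow> f x \<in> C"
  shows "g x \<in> C"
  using assms(1) by induction (auto intro: assms midpoint_in_convex)

lemma midpoint_hull_measurable:
  fixes A :: "('c \<Rightarrow> 'b::euclidean_space) set"
  assumes "g \<in> midpoint_hull A" "A \<subseteq> borel_measurable M"
  shows "g \<in> borel_measurable M"
  using assms(1) 
proof induction
  case (base f)
  then show ?case using assms by auto
next
  case (mid f g)
  then show ?case unfolding midpoint_def by measurable
qed

text \<open>
The parallelogram law, in the form that makes minimizing sequences Cauchy.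
\<close>

lemma midpoint_parallelogram:
  fixes a b :: "'b::real_inner"
  shows "(norm (a - b))\<^sup>2 = 2 * (norm a)\<^sup>2 + 2 * (norm b)\<^sup>2 - 4 * (norm (midpoint a b))\<^sup>2"
  by (simp add: midpoint_def power2_norm_eq_inner inner_simps inner_commute field_simps)

text \<open>
A substitute for weak compactness in \<open>L\<^sup>1\<close>. Dividing the squared norm by the dominating function \<open>m\<close>
gives a Hilbert seminorm that is finite on everything dominated by \<open>m\<close>. From the hull of each tail
pick an almost minimizer of this seminorm. The infima increase as the tails shrink and are bounded, so
they converge, and the parallelogram law turns this into the Cauchy property. The weighted seminorm
controls the \<open>L\<^sup>1\<close> norm, and a Cauchy sequence in \<open>L\<^sup>1\<close> has a subsequence that converges almost
everywhere.
\<close>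

lemma dominated_tail_midpoints_converge:
  fixes h :: "nat \<Rightarrow> 'c \<Rightarrow> 'b::euclidean_space"
  assumes h: "\<And>j. h j \<in> borel_measurable M" and bound: "\<And>j x. norm (h j x) \<le> m x"
    and m: "integrable M m"
  obtains g l where "\<And>k. g k \<in> midpoint_hull (h ` {k..})" "l \<in> borel_measurable M"
    "AE x in M. (\<lambda>k. g k x) \<longlonglongrightarrow> l x"
proof -
  define C where "C k = midpoint_hull (h ` {k..})" for k
  \<comment> \<open>Where \<open>m x = 0\<close>, all the functions vanish, and division by zero gives the right value 0.\<close>
  define N where "N g = (LINT x|M. (norm (g x))\<^sup>2 / m x)" for g :: "'c \<Rightarrow> 'b"
  have m0: "0 \<le> m x" for x
    using bound[of 0 x] norm_ge_zero order_trans by blast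
  have C_mono: "C k \<subseteq> C j" if "j \<le> k" for j k
    unfolding C_def using that by (intro midpoint_hull_mono) auto
  have C_meas [measurable (raw)]: "g \<in> borel_measurable M" if "g \<in> C k" for g k
    using that h unfolding C_def by (auto intro: midpoint_hull_measurable)
  have C_bound: "norm (g x) \<le> m x" if "g \<in> C k" for g k x
    using midpoint_hull_in_convex[OF that[unfolded C_def], of "cball 0 (m x)" x] bound by auto
  have [measurable]: "m \<in> borel_measurable M"
    using m by simp
  have sq_le: "(norm a)\<^sup>2 / m x \<le> m x" if "norm a \<le> m x" for a :: 'b and x
  proof (cases "m x = 0")
    case False
    then have "(norm a)\<^sup>2 \<le> m x * m x"
      using that by (simp add: power2_eq_square mult_mono m0)
    then show ?thesis using False m0[of x] by (simp add: divide_le_eq)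
  qed (use m0 in auto)
  have int: "integrable M (\<lambda>x. (norm (g x))\<^sup>2 / m x)"
    if [measurable]: "g \<in> borel_measurable M" and "\<And>x. norm (g x) \<le> m x" for g :: "'c \<Rightarrow> 'b"
  proof (rule Bochner_Integration.integrable_bound[OF m])
    show "AE x in M. norm ((norm (g x))\<^sup>2 / m x) \<le> norm (m x)"
      using sq_le[OF that(2)] m0 by (intro AE_I2) (simp add: abs_of_nonneg)
  qed measurable
  note intC = int[OF C_meas C_bound]
  have N_le: "N g \<le> integral\<^sup>L M m" if "g \<in> C k" for g k
    unfolding N_def by (intro integral_mono intC[OF that that] m sq_le C_bound[OF that])
  have N_ge: "0 \<le> N g" for g
    unfolding N_def by (intro integral_nonneg_AE) (auto simp: m0)
  define D where "D k = (INF g\<in>C k. N g)" for k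
  have C_ne: "h k \<in> C k" for k
    unfolding C_def by (auto intro: midpoint_hull.base)
  have bdd: "bdd_below (N ` C k)" for k
    using N_ge by (auto intro!: bdd_belowI[of _ 0])
  have D_le: "D k \<le> N g" if "g \<in> C k" for g k
    unfolding D_def by (rule cINF_lower[OF bdd that])
  have "incseq D"
    unfolding incseq_def D_def by (intro allI impI cINF_superset_mono bdd C_mono) (use C_ne in auto)
  moreover have "D k \<le> integral\<^sup>L M m" for k
    using D_le[OF C_ne] N_le[OF C_ne] by (rule order_trans)
  ultimately obtain d where d: "D \<longlonglongrightarrow> d" "\<And>k. D k \<le> d"
    using incseq_convergent[of D] by metis
  have "\<exists>g\<in>C k. N g < D k + inverse (Suc k)" for k
  proof -
    have "Inf (N ` C k) < D k + inverse (Suc k)"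
      unfolding D_def by simp
    then show ?thesis
      using C_ne[of k] bdd by (subst (asm) cInf_less_iff) auto
  qed
  then obtain g where gC: "\<And>k. g k \<in> C k" and gN: "\<And>k. N (g k) < D k + inverse (Suc k)"
    by metis
  have gint: "integrable M (\<lambda>x. g i x)" for i
    by (rule Bochner_Integration.integrable_bound[OF m])
       (use C_meas[OF gC] C_bound[OF gC] m0 in auto)
  have near: "N (\<lambda>x. g i x - g j x) \<le> 4 * (d - D k + inverse (Suc k))" if "k \<le> i" "k \<le> j" for i j k
  proof -
    have ij: "g i \<in> C k" "g j \<in> C k"
      using C_mono that gC by blast+
    then have mid: "(\<lambda>x. midpoint (g i x) (g j x)) \<in> C k"
      unfolding C_def by (rule midpoint_hull.mid)
    have "N (\<lambda>x. g i x - g j x) = 2 * N (g i) + 2 * N (g j) - 4 * N (\<lambda>x. midpoint (g i x) (g j x))"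
      unfolding N_def midpoint_parallelogram diff_divide_distrib add_divide_distrib times_divide_eq_right[symmetric]
      using intC[OF ij(1) ij(1)] intC[OF ij(2) ij(2)] intC[OF mid mid]
      by (simp del: times_divide_eq_right)
    moreover have "inverse (real (Suc i)) \<le> inverse (Suc k)" "inverse (real (Suc j)) \<le> inverse (Suc k)"
      using that by (intro le_imp_inverse_le; simp)+
    then have "N (g i) \<le> d + inverse (Suc k)" "N (g j) \<le> d + inverse (Suc k)"
      using gN[of i] gN[of j] d(2)[of i] d(2)[of j] by linarith+
    ultimately show ?thesis
      using D_le[OF mid] by simp
  qed
  have L1: "(LINT x|M. norm (g i x - g j x)) \<le> e * integral\<^sup>L M m + N (\<lambda>x. g i x - g j x) / e"
    if "0 < e" for e i j
  proof -
    have dint: "integrable M (\<lambda>x. (norm (g i x - g j x))\<^sup>2 / m x)"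
    proof (rule Bochner_Integration.integrable_bound)
      show "integrable M (\<lambda>x. 2 * ((norm (g i x))\<^sup>2 / m x) + 2 * ((norm (g j x))\<^sup>2 / m x))"
        using intC[OF gC gC] by (simp del: times_divide_eq_right)
      show "(\<lambda>x. (norm (g i x - g j x))\<^sup>2 / m x) \<in> borel_measurable M"
        using C_meas[OF gC] by measurable
      show "AE x in M. norm ((norm (g i x - g j x))\<^sup>2 / m x)
          \<le> norm (2 * ((norm (g i x))\<^sup>2 / m x) + 2 * ((norm (g j x))\<^sup>2 / m x))"
      proof (rule AE_I2)
        fix x
        have "(norm (g i x - g j x))\<^sup>2 / m x \<le> (2 * (norm (g i x))\<^sup>2 + 2 * (norm (g j x))\<^sup>2) / m x"
          using midpoint_parallelogram[of "g i x" "g j x"] m0 by (intro divide_right_mono) auto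
        then show "norm ((norm (g i x - g j x))\<^sup>2 / m x)
            \<le> norm (2 * ((norm (g i x))\<^sup>2 / m x) + 2 * ((norm (g j x))\<^sup>2 / m x))"
          using m0 by (simp add: add_divide_distrib)
      qed
    qed
    \<comment> \<open>Young's inequality for the factors \<open>e * m x\<close> and \<open>norm (g i x - g j x)\<close>.\<close>
    have "norm (g i x - g j x) \<le> e * m x + ((norm (g i x - g j x))\<^sup>2 / m x) / e" for x
    proof (cases "m x = 0")
      case True
      then show ?thesis using C_bound[OF gC[of i], of x] C_bound[OF gC[of j], of x] by simp
    next
      case False
      let ?a = "norm (g i x - g j x)"
      have "0 < m x" using False m0[of x] by simp
      have "?a * (e * m x) \<le> (e * m x)\<^sup>2 + ?a\<^sup>2"
        using sum_squares_bound[of ?a "e * m x"] mult_nonneg_nonneg[OF norm_ge_zero mult_nonneg_nonneg[of e "m x"], of "g i x - g j x"]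
          m0[of x] that by linarith
      then show ?thesis
        using \<open>0 < m x\<close> that by (simp add: field_simps power2_eq_square)
    qed
    then have "(LINT x|M. norm (g i x - g j x)) \<le> (LINT x|M. e * m x + ((norm (g i x - g j x))\<^sup>2 / m x) / e)"
      using gint m dint by (intro integral_mono) (auto simp del: divide_divide_eq_left)
    also have "\<dots> = e * integral\<^sup>L M m + N (\<lambda>x. g i x - g j x) / e"
      using m dint by (simp add: N_def del: divide_divide_eq_left)
    finally show ?thesis .
  qed
  have I0: "0 \<le> integral\<^sup>L M m" using m0 by (simp add: integral_nonneg_AE)
  have "\<exists>n. \<forall>i\<ge>n. \<forall>j\<ge>n. (LINT x|M. norm (g i x - g j x)) < e" if "0 < e" for e
  proof -
    define e' where "e' = e / (2 * (integral\<^sup>L M m + 1))"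
    have e': "0 < e'" "e' * integral\<^sup>L M m < e / 2"
      using that I0 by (auto simp: e'_def field_simps)
    have "(\<lambda>k. 4 * (d - D k + inverse (Suc k)) / e') \<longlonglongrightarrow> 4 * (d - d + 0) / e'"
      using e' by (intro tendsto_intros d LIMSEQ_inverse_real_of_nat) auto
    then have "\<forall>\<^sub>F k in sequentially. 4 * (d - D k + inverse (Suc k)) / e' < e / 2"
      using that by (intro order_tendstoD(2)) auto
    then obtain n where n: "4 * (d - D n + inverse (Suc n)) / e' < e / 2"
      by (auto simp: eventually_sequentially)
    have "(LINT x|M. norm (g i x - g j x)) < e" if "n \<le> i" "n \<le> j" for i j
      using L1[OF e'(1), of i j] e'(2) n divide_right_mono[OF near[OF that], of e'] e'(1) by linarith
    then show ?thesis by blast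
  qed
  then obtain r where r: "strict_mono r" "AE x in M. Cauchy (\<lambda>i. g (r i) x)"
    by (rule cauchy_L1_AE_cauchy_subseq[of M g, OF gint])
  show thesis
  proof
    show "g (r k) \<in> midpoint_hull (h ` {k..})" for k
      using gC[of "r k"] C_mono[OF seq_suble[OF r(1), of k]] unfolding C_def by blast
    show "(\<lambda>x. lim (\<lambda>k. g (r k) x)) \<in> borel_measurable M"
      using C_meas[OF gC] by (intro borel_measurable_lim_metric)
    show "AE x in M. (\<lambda>k. g (r k) x) \<longlonglongrightarrow> lim (\<lambda>k. g (r k) x)"
      using r(2) by eventually_elim (simp add: Cauchy_convergent_iff convergent_LIMSEQ_iff)
  qed
qed

section \<open>Differential inclusions with a causal right-hand side\<close>

text \<open>
The admissible right-hand sides. The bound holds at every time, not only almost everywhere, because a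
Volterra operator below is bounded and applied at every single time.
\<close>

definition dominated :: "(real \<Rightarrow> real) \<Rightarrow> (real \<Rightarrow> 'b::euclidean_space) \<Rightarrow> bool" where
  "dominated m h \<longleftrightarrow> h \<in> borel_measurable borel \<and> (\<forall>s. norm (h s) \<le> m s)"

text \<open>
An abstraction of \<open>S h s = fst (h s) + \<integral> P (s, \<tau>) (snd (h \<tau>)) d\<tau>\<close>. Compatibility with midpoints stands
for affinity. Convergence is asked for almost everywhere only, because the first summand depends on
the value of \<open>h\<close> at \<open>s\<close> itself.
\<close>

locale volterra_operator =
  fixes S :: "(real \<Rightarrow> 'b::euclidean_space) \<Rightarrow> real \<Rightarrow> 'a::euclidean_space"
    and m W :: "real \<Rightarrow> real"
  assumes m_integrable: "integrable lborel m"
    and W_integrable: "integrable lborel W"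
    and S_measurable: "dominated m h \<Longrightarrow> S h \<in> borel_measurable borel"
    and S_bound: "dominated m h \<Longrightarrow> norm (S h s) \<le> W s"
    and S_midpoint: "\<lbrakk>dominated m g; dominated m h\<rbrakk> \<Longrightarrow>
        S (\<lambda>s. midpoint (g s) (h s)) = (\<lambda>s. midpoint (S g s) (S h s))"
    and S_causal: "(\<And>\<tau>. \<tau> \<le> s \<Longrightarrow> g \<tau> = h \<tau>) \<Longrightarrow> S g s = S h s"
    and S_tendsto: "\<lbrakk>\<And>k. dominated m (u k); dominated m h; AE s in lborel. (\<lambda>k. u k s) \<longlonglongrightarrow> h s\<rbrakk>
        \<Longrightarrow> AE s in lborel. (\<lambda>k. S (u k) s) \<longlonglongrightarrow> S h s"
begin

lemma dominatedD: "dominated m h \<Longrightarrow> h \<in> borel_measurable borel" "dominated m h \<Longrightarrow> norm (h s) \<le> m s"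
  by (auto simp: dominated_def)

lemma S_integrable: "dominated m h \<Longrightarrow> integrable lborel (S h)"
  by (rule Bochner_Integration.integrable_bound[OF W_integrable])
     (auto simp: S_measurable intro!: AE_I2 order_trans[OF S_bound])

lemma dominated_midpoint:
  assumes "dominated m g" "dominated m h" shows "dominated m (\<lambda>s. midpoint (g s) (h s))"
proof -
  have [measurable]: "g \<in> borel_measurable borel" "h \<in> borel_measurable borel"
    using assms by (auto simp: dominated_def)
  have "norm (midpoint (g s) (h s)) \<le> m s" for s
    using midpoint_in_convex[of "cball 0 (m s)" "g s" "h s"] assms by (auto simp: dominated_def)
  moreover have "(\<lambda>s. midpoint (g s) (h s)) \<in> borel_measurable borel"
    unfolding midpoint_def by measurable
  ultimately show ?thesis by (simp add: dominated_def)
qed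

lemma midpoint_hull_dominated:
  assumes "g \<in> midpoint_hull A" "\<And>h. h \<in> A \<Longrightarrow> dominated m h"
  shows "dominated m g"
  using assms(1) by induction (auto intro: assms dominated_midpoint)

text \<open>
With a small ball for \<open>C\<close> this says that combinations of trajectories close to a common point remain
close to it.
\<close>

lemma midpoint_hull_primitive_in_convex:
  assumes "g \<in> midpoint_hull A" "\<And>h. h \<in> A \<Longrightarrow> dominated m h"
    and "convex C" "\<And>h. h \<in> A \<Longrightarrow> primitive_from a c (S h) t \<in> C"
  shows "primitive_from a c (S g) t \<in> C"
  using assms(1)
proof induction
  case (mid f g)
  then have "dominated m f" "dominated m g"
    using midpoint_hull_dominated assms(2) by blast+
  with mid show ?case
    by (simp add: S_midpoint primitive_from_midpoint S_integrable midpoint_in_convex[OF assms(3)])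
qed (use assms in auto)

lemma primitive_tendsto:
  assumes g: "\<And>k. dominated m (g k)" and h: "dominated m h" and lim: "AE s in lborel. (\<lambda>k. g k s) \<longlonglongrightarrow> h s"
  shows "(\<lambda>k. primitive_from a c (S (g k)) t) \<longlonglongrightarrow> primitive_from a c (S h) t"
  unfolding primitive_from_def set_lebesgue_integral_def
proof (intro tendsto_add tendsto_const integral_dominated_convergence[where w = W])
  have [measurable]: "S h \<in> borel_measurable borel" "S (g k) \<in> borel_measurable borel" for k
    using S_measurable g h by auto
  show "(\<lambda>s. indicat_real {a..t} s *\<^sub>R S h s) \<in> borel_measurable lborel"
    "(\<lambda>s. indicat_real {a..t} s *\<^sub>R S (g k) s) \<in> borel_measurable lborel" for k
    by measurable
  show "AE s in lborel. (\<lambda>k. indicat_real {a..t} s *\<^sub>R S (g k) s) \<longlonglongrightarrow> indicat_real {a..t} s *\<^sub>R S h s"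
    using S_tendsto[OF g h lim] by eventually_elim (intro tendsto_intros)
  show "AE s in lborel. norm (indicat_real {a..t} s *\<^sub>R S (g k) s) \<le> W s" for k
    using S_bound[OF g[of k]] order_trans[OF norm_ge_zero S_bound[OF h]]
    by (intro AE_I2) (auto simp: indicator_def)
qed (rule W_integrable)

text \<open>
The method of steps. By causality the iterate \<open>\<psi> (Suc n)\<close> depends up to time \<open>t\<close> only on \<open>\<psi> n\<close> up to time
\<open>t - d\<close>, so iteration number \<open>n\<close> is already final up to time \<open>a + n * d\<close>, and finitely many iterations
reach \<open>b\<close>. The maximum with \<open>a\<close> freezes the delayed argument at the initial time.
\<close>

lemma delayed_solution:
  fixes H :: "real \<times> 'a \<Rightarrow> 'b"
  assumes H [measurable]: "H \<in> borel_measurable borel" and H_bound: "\<And>s y. norm (H (s, y)) \<le> m s"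
    and d: "0 < d" and \<rho>: "0 < \<rho>"
  obtains h where "dominated m h"
    "\<And>s. s \<in> {a..b} \<Longrightarrow> h s = ball_average \<rho> (\<lambda>y. H (s, y)) (primitive_from a c (S h) (max a (s - d)))"
proof -
  define \<phi> where "\<phi> y = (\<lambda>s. ball_average \<rho> (\<lambda>z. H (s, z)) (y (max a (s - d))))" for y
  define \<psi> where "\<psi> = rec_nat (\<lambda>_. c) (\<lambda>_ y. primitive_from a c (S (\<phi> y)))"
  have \<psi>_simps: "\<psi> 0 = (\<lambda>_. c)" "\<psi> (Suc n) = primitive_from a c (S (\<phi> (\<psi> n)))" for n
    by (auto simp: \<psi>_def)
  have \<phi>_adm: "dominated m (\<phi> y)" if [measurable]: "y \<in> borel_measurable borel" for y
    unfolding dominated_def \<phi>_def by (auto intro!: norm_ball_average_le \<rho> H_bound ball_average_measurable H)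
  have \<psi>_meas: "\<psi> n \<in> borel_measurable borel" for n
  proof (induction n)
    case (Suc n)
    then show ?case by (auto simp: \<psi>_simps intro!: primitive_from_measurable S_measurable \<phi>_adm)
  qed (simp add: \<psi>_simps)
  have stable: "\<psi> (Suc n) t = \<psi> n t" if "t \<le> a + n * d" for n t
    using that
  proof (induction n arbitrary: t)
    case 0
    then show ?case
      using primitive_from_initial[OF S_integrable[OF \<phi>_adm[OF \<psi>_meas[of 0]]], of t a c] by (simp add: \<psi>_simps)
  next
    case (Suc n)
    have "S (\<phi> (\<psi> (Suc n))) s = S (\<phi> (\<psi> n)) s" if "s \<le> t" for s
    proof (rule S_causal)
      fix \<tau> assume "\<tau> \<le> s"
      then have "max a (\<tau> - d) \<le> a + n * d"
        using Suc.prems that d by (auto simp: algebra_simps)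
      then show "\<phi> (\<psi> (Suc n)) \<tau> = \<phi> (\<psi> n) \<tau>"
        unfolding \<phi>_def by (simp only: Suc.IH)
    qed
    then show ?case
      unfolding \<psi>_simps(2)[of "Suc n"] \<psi>_simps(2)[of n] by (intro primitive_from_cong)
  qed
  obtain n :: nat where "b - a \<le> n * d"
    using reals_Archimedean3[OF d] less_imp_le by blast
  show thesis
  proof
    show "dominated m (\<phi> (\<psi> n))" using \<phi>_adm \<psi>_meas .
    show "\<phi> (\<psi> n) s = ball_average \<rho> (\<lambda>y. H (s, y)) (primitive_from a c (S (\<phi> (\<psi> n))) (max a (s - d)))"
      if "s \<in> {a..b}" for s
    proof -
      have "max a (s - d) \<le> a + n * d"
        using that \<open>b - a \<le> n * d\<close> d by auto
      from stable[OF this] show ?thesis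
        by (simp add: \<psi>_simps(2) \<phi>_def)
    qed
  qed
qed

lemma primitive_equicontinuous:
  assumes "t \<in> {a..b}" "0 < e"
  shows "\<exists>d>0. \<forall>h t'. dominated m h \<and> t' \<in> {a..b} \<and> norm (t - t') < d \<longrightarrow>
      norm (primitive_from a c (S h) t - primitive_from a c (S h) t') < e"
proof -
  let ?V = "primitive_from a 0 W"
  have le: "norm (primitive_from a c (S h) t - primitive_from a c (S h) t') \<le> \<bar>?V t' - ?V t\<bar>" if "dominated m h" for h t'
    using norm_primitive_from_diff_le[OF S_integrable[OF that] W_integrable S_bound[OF that], of t t' a c]
      norm_primitive_from_diff_le[OF S_integrable[OF that] W_integrable S_bound[OF that], of t' t a c]
    by (cases "t \<le> t'") (auto simp: norm_minus_commute)
  obtain d where "d > 0" "\<And>t'. t' \<in> {a..b} \<Longrightarrow> dist t' t < d \<Longrightarrow> dist (?V t') (?V t) < e"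
    using continuous_on_primitive_from[OF W_integrable, of a b 0] assms unfolding continuous_on_iff by metis
  then show ?thesis
    using le by (intro exI[of _ d]) (auto simp: dist_real_def abs_minus_commute intro: le_less_trans)
qed

text \<open>
Global existence for the inclusion \<open>x' = S h\<close>, \<open>h s\<close> in the regularization of \<open>H (s, \<cdot>)\<close> at \<open>x s\<close>, with
trajectory \<open>x = primitive_from a c (S h)\<close>: delays and averaging radii \<open>\<epsilon> n\<close> tend to 0, \<open>X\<close> is the uniform
limit of the approximate trajectories, and the almost everywhere limit of tail combinations of their
right-hand sides provides \<open>h\<close>.
\<close>

proposition inclusion_solution:
  fixes H :: "real \<times> 'a \<Rightarrow> 'b"
  assumes H: "H \<in> borel_measurable borel" and H_bound: "\<And>s y. norm (H (s, y)) \<le> m s"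
  obtains h where "dominated m h"
    "AE s in lborel. s \<in> {a..b} \<longrightarrow>
      h s \<in> (\<Inter>\<delta>\<in>{0<..}. ess_hull (\<lambda>y. H (s, y)) (ball (primitive_from a c (S h) s) \<delta>))"
proof -
  define \<epsilon> where "\<epsilon> n = inverse (real (Suc n))" for n
  have \<epsilon>: "0 < \<epsilon> n" for n by (simp add: \<epsilon>_def)
  have \<epsilon>_lim: "\<epsilon> \<longlonglongrightarrow> 0" unfolding \<epsilon>_def by (rule LIMSEQ_inverse_real_of_nat)
  have "\<forall>n. \<exists>h. dominated m h \<and> (\<forall>s\<in>{a..b}.
      h s = ball_average (\<epsilon> n) (\<lambda>y. H (s, y)) (primitive_from a c (S h) (max a (s - \<epsilon> n))))" (is "\<forall>n. ?P n")
  proof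
    fix n
    show "?P n" by (rule delayed_solution[OF H H_bound \<epsilon>[of n] \<epsilon>[of n], of a b c]) blast
  qed
  from choice[OF this] obtain h where h: "\<And>n. dominated m (h n)" and
    h_eq: "\<And>n s. s \<in> {a..b} \<Longrightarrow>
      h n s = ball_average (\<epsilon> n) (\<lambda>y. H (s, y)) (primitive_from a c (S (h n)) (max a (s - \<epsilon> n)))"
    by blast
  define x where "x n = primitive_from a c (S (h n))" for n
  obtain X r where X: "continuous_on {a..b} X" and r: "strict_mono (r :: nat \<Rightarrow> nat)" and
    unif: "\<And>e. 0 < e \<Longrightarrow> \<exists>N. \<forall>n t. n \<ge> N \<and> t \<in> {a..b} \<longrightarrow> norm (x (r n) t - X t) < e"
  proof (rule Arzela_Ascoli[of "{a..b}" x])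
    show "norm (x n t) \<le> norm c + integral\<^sup>L lborel W" for n t
      unfolding x_def using norm_primitive_from_le[OF S_integrable[OF h] W_integrable S_bound[OF h]] .
    show "\<exists>d>0. \<forall>n y. y \<in> {a..b} \<and> norm (t - y) < d \<longrightarrow> norm (x n t - x n y) < e" 
      if "t \<in> {a..b}" "0 < e" for t e
      using primitive_equicontinuous[OF that, of c] h unfolding x_def by blast
  qed auto
  obtain g l where g: "\<And>k. g k \<in> midpoint_hull ((\<lambda>j. h (r j)) ` {k..})" and
    l: "l \<in> borel_measurable lborel" "AE s in lborel. (\<lambda>k. g k s) \<longlonglongrightarrow> l s"
    using dominated_tail_midpoints_converge[of "\<lambda>j. h (r j)" lborel m] h m_integrable
    by (auto simp: dominated_def)
  have g_adm: "dominated m (g k)" for k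
    using midpoint_hull_dominated[OF g] h by auto
  \<comment> \<open>The limit is dominated by \<open>m\<close> only almost everywhere; the cut-off makes it dominated.\<close>
  define l' where "l' s = (if norm (l s) \<le> m s then l s else 0)" for s
  have l'_lim: "AE s in lborel. (\<lambda>k. g k s) \<longlonglongrightarrow> l' s"
    using l(2)
  proof eventually_elim
    case (elim s)
    have "norm (l s) \<le> m s"
      using tendsto_norm[OF elim] dominatedD(2)[OF g_adm] by (intro LIMSEQ_le_const2) auto
    then show ?case using elim by (simp add: l'_def)
  qed
  have [measurable]: "m \<in> borel_measurable borel" "l \<in> borel_measurable borel"
    using m_integrable l(1) by (auto dest: borel_measurable_integrable)
  have m0: "0 \<le> m s" for s
    using dominatedD(2)[OF h, of 0 s] norm_ge_zero order_trans by blast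
  have l'_adm: "dominated m l'"
    unfolding dominated_def l'_def using m0 by (auto intro!: measurable_If)
  \<comment> \<open>Both limits of the combined trajectories: by continuity of \<open>S\<close>, and by uniform convergence.\<close>
  have X_eq: "primitive_from a c (S l') t = X t" if t: "t \<in> {a..b}" for t
  proof (rule LIMSEQ_unique[OF primitive_tendsto[OF g_adm l'_adm l'_lim]])
    show "(\<lambda>k. primitive_from a c (S (g k)) t) \<longlonglongrightarrow> X t"
    proof (rule metric_LIMSEQ_I)
      fix e :: real assume "0 < e"
      then obtain N where N: "\<And>n. N \<le> n \<Longrightarrow> norm (x (r n) t - X t) < e"
        using unif t by blast
      have "primitive_from a c (S (g k)) t \<in> ball (X t) e" if "N \<le> k" for k
        by (rule midpoint_hull_primitive_in_convex[OF g])
           (use h N that in \<open>auto simp: x_def dist_norm norm_minus_commute\<close>)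
      then show "\<exists>N. \<forall>k\<ge>N. dist (primitive_from a c (S (g k)) t) (X t) < e"
        by (auto simp: dist_commute)
    qed
  qed
  show thesis
  proof
    show "dominated m l'" by (rule l'_adm)
    show "AE s in lborel. s \<in> {a..b} \<longrightarrow>
      l' s \<in> (\<Inter>\<delta>\<in>{0<..}. ess_hull (\<lambda>y. H (s, y)) (ball (primitive_from a c (S l') s) \<delta>))"
      using l'_lim
    proof eventually_elim
      case (elim s)
      have "l' s \<in> ess_hull (\<lambda>y. H (s, y)) (ball (X s) \<delta>)" (is "_ \<in> ?C") if s: "s \<in> {a..b}" and "0 < \<delta>" for \<delta>
      proof -
        \<comment> \<open>The averages entering \<open>h (r n) s\<close> are centred at the trajectory at time \<open>\<sigma> n\<close>.\<close>
        define \<sigma> where "\<sigma> n = max a (s - \<epsilon> (r n))" for n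
        have \<epsilon>r: "(\<lambda>n. \<epsilon> (r n)) \<longlonglongrightarrow> 0"
          using LIMSEQ_subseq_LIMSEQ[OF \<epsilon>_lim r] by (simp add: comp_def)
        have \<sigma>: "\<sigma> n \<in> {a..b}" for n
          using s \<epsilon>[of "r n"] by (auto simp: \<sigma>_def)
        have "\<sigma> \<longlonglongrightarrow> max a (s - 0)"
          unfolding \<sigma>_def by (intro tendsto_intros \<epsilon>r)
        then have "\<sigma> \<longlonglongrightarrow> s" using s by (simp add: max_def)
        then have "(\<lambda>n. X (\<sigma> n)) \<longlonglongrightarrow> X s"
          using continuous_on_tendsto_compose[OF X \<open>\<sigma> \<longlonglongrightarrow> s\<close> s] \<sigma> by simp
        then have "\<forall>\<^sub>F n in sequentially. dist (X (\<sigma> n)) (X s) < \<delta> / 3"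
          using \<open>0 < \<delta>\<close> by (intro tendstoD) auto
        moreover have "\<forall>\<^sub>F n in sequentially. \<epsilon> (r n) < \<delta> / 3"
          using \<open>0 < \<delta>\<close> by (intro order_tendstoD(2)[OF \<epsilon>r]) auto
        moreover obtain N where "\<And>n t. n \<ge> N \<Longrightarrow> t \<in> {a..b} \<Longrightarrow> norm (x (r n) t - X t) < \<delta> / 3"
          using unif[of "\<delta> / 3"] \<open>0 < \<delta>\<close> by auto
        then have "\<forall>\<^sub>F n in sequentially. dist (x (r n) (\<sigma> n)) (X (\<sigma> n)) < \<delta> / 3"
          using \<sigma> by (auto simp: eventually_sequentially dist_norm)
        ultimately have "\<forall>\<^sub>F n in sequentially. h (r n) s \<in> ?C"
        proof eventually_elim
          case (elim n)
          have "h (r n) s \<in> ess_hull (\<lambda>y. H (s, y)) (ball (x (r n) (\<sigma> n)) (\<epsilon> (r n)))"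
            unfolding h_eq[OF s] x_def \<sigma>_def
            by (rule ball_average_in_ess_hull[OF _ H_bound \<epsilon>]) (use H in measurable)
          moreover have le: "dist (x (r n) (\<sigma> n)) (X s) + \<epsilon> (r n) \<le> \<delta>"
            using elim dist_triangle[of "x (r n) (\<sigma> n)" "X s" "X (\<sigma> n)"] by linarith
          have "ball (x (r n) (\<sigma> n)) (\<epsilon> (r n)) \<subseteq> ball (X s) \<delta>"
          proof (intro subsetI)
            fix z assume "z \<in> ball (x (r n) (\<sigma> n)) (\<epsilon> (r n))"
            then show "z \<in> ball (X s) \<delta>"
              using le dist_triangle3[of "X s" z "x (r n) (\<sigma> n)"] by simp
          qed
          ultimately show ?case using ess_hull_mono by blast
        qed
        then obtain N where N: "\<And>n. N \<le> n \<Longrightarrow> h (r n) s \<in> ?C"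
          by (auto simp: eventually_sequentially)
        have "g k s \<in> ?C" if "N \<le> k" for k
          by (rule midpoint_hull_in_convex[OF g convex_ess_hull]) (use N that in auto)
        then show ?thesis
          by (intro Lim_in_closed_set[OF closed_ess_hull _ _ elim]) (auto simp: eventually_sequentially)
      qed
      then show ?case using X_eq by auto
    qed
  qed
qed

end

section \<open>The memory operator of the integro-differential equation\<close>

lemma matrix_vector_mult_bounded_bilinear:
  "bounded_bilinear ((*v) :: real^'n^'m \<Rightarrow> real^'n \<Rightarrow> real^'m)"
  by (rule bilinear_conv_bounded_bilinear[THEN iffD1])
     (auto simp: bilinear_def matrix_vector_mul_linear intro!: linearI
           simp: matrix_vector_mult_add_rdistrib scaleR_matrix_vector_assoc)


lemma matrix_vector_mult_measurable [measurable (raw)]: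
  fixes A :: "'c \<Rightarrow> real^'n^'m"
  assumes "A \<in> borel_measurable M" "u \<in> borel_measurable M"
  shows "(\<lambda>x. A x *v u x) \<in> borel_measurable M"
  using assms
  by (rule borel_measurable_continuous_Pair)
     (intro bounded_bilinear.continuous_on[OF matrix_vector_mult_bounded_bilinear] continuous_intros)

lemma dominated_components:
  fixes h :: "real \<Rightarrow> 'a::euclidean_space \<times> 'b::euclidean_space"
  assumes "dominated m h"
  shows "(\<lambda>s. fst (h s)) \<in> borel_measurable borel" "(\<lambda>s. snd (h s)) \<in> borel_measurable borel"
    "norm (fst (h s)) \<le> m s" "norm (snd (h s)) \<le> m s"
proof -
  have "h \<in> borel \<rightarrow>\<^sub>M borel \<Otimes>\<^sub>M borel" using assms by (simp add: borel_prod dominated_def)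
  then show "(\<lambda>s. fst (h s)) \<in> borel_measurable borel" "(\<lambda>s. snd (h s)) \<in> borel_measurable borel"
    by auto
  have "norm (h s) \<le> m s" using assms by (simp add: dominated_def)
  then show "norm (fst (h s)) \<le> m s" "norm (snd (h s)) \<le> m s"
    by (cases "h s"; auto intro: order_trans[OF norm_fst_le] order_trans[OF norm_snd_le])+
qed

lemma memory_integrand:
  fixes P :: "real \<times> real \<Rightarrow> real^'n^'n" and h :: "real \<Rightarrow> (real^'n) \<times> (real^'n)"
  assumes P: "P \<in> borel_measurable borel" and B: "0 \<le> B" "\<And>z u. norm (P z *v u) \<le> B * norm u"
    and m: "integrable lborel m" and h: "dominated m h"
  shows "norm (P (s, \<tau>) *v snd (h \<tau>)) \<le> B * m \<tau>"
    and "integrable lborel (\<lambda>\<tau>. P (s, \<tau>) *v snd (h \<tau>))"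
proof -
  have Pp [measurable]: "P \<in> borel_measurable (borel \<Otimes>\<^sub>M borel)"
    using P by (simp add: borel_prod)
  note [measurable] = dominated_components(2)[OF h]
  show le: "norm (P (s, \<tau>) *v snd (h \<tau>)) \<le> B * m \<tau>" for \<tau>
    by (intro order_trans[OF B(2)] mult_left_mono B(1) dominated_components(4)[OF h])
  show "integrable lborel (\<lambda>\<tau>. P (s, \<tau>) *v snd (h \<tau>))"
  proof (rule Bochner_Integration.integrable_bound)
    show "integrable lborel (\<lambda>\<tau>. B * m \<tau>)" using m by simp
    show "AE \<tau> in lborel. norm (P (s, \<tau>) *v snd (h \<tau>)) \<le> norm (B * m \<tau>)"
      using le by (intro AE_I2) (auto intro: order_trans[OF _ abs_ge_self])
    show "(\<lambda>\<tau>. P (s, \<tau>) *v snd (h \<tau>)) \<in> borel_measurable lborel" by simp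
  qed
qed

definition memory_operator ::
    "(real \<times> real \<Rightarrow> real^'n^'n) \<Rightarrow> (real \<Rightarrow> (real^'n) \<times> (real^'n)) \<Rightarrow> real \<Rightarrow> real^'n" where
  "memory_operator P h s = fst (h s) + (LINT \<tau>|lborel. P (s, \<tau>) *v snd (h \<tau>))"

text \<open>
The support condition on \<open>P\<close> encodes causality and the start of the memory at time \<open>a\<close>, so the memory
integral can be taken over the whole line.
\<close>

lemma volterra_memory_operator:
  fixes P :: "real \<times> real \<Rightarrow> real^'n^'n"
  assumes P: "P \<in> borel_measurable borel" and B: "0 \<le> B" "\<And>z u. norm (P z *v u) \<le> B * norm u"
    and support: "\<And>s \<tau>. \<not> (a \<le> \<tau> \<and> \<tau> \<le> s \<and> s \<le> b) \<Longrightarrow> P (s, \<tau>) = 0"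
    and m: "integrable lborel m"
  shows "volterra_operator (memory_operator P) m (\<lambda>s. m s + indicator {a..b} s * (B * integral\<^sup>L lborel m))"
proof
  let ?W = "\<lambda>s. m s + indicator {a..b} s * (B * integral\<^sup>L lborel m)"
  have Pp [measurable]: "P \<in> borel_measurable (borel \<Otimes>\<^sub>M borel)"
    using P by (simp add: borel_prod)
  note integrand_le = memory_integrand(1)[OF P B m] and int = memory_integrand(2)[OF P B m]
  show "integrable lborel m" by (rule m)
  show "integrable lborel ?W"
    by (intro Bochner_Integration.integrable_add m integrable_mult_left integrable_real_indicator)
       (auto simp: emeasure_lborel_Icc_eq)
  show "memory_operator P h \<in> borel_measurable borel" if "dominated m h" for h
  proof -
    note [measurable] = dominated_components(1,2)[OF that]
    show ?thesis unfolding memory_operator_def by measurable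
  qed
  show "norm (memory_operator P h s) \<le> ?W s" if h: "dominated m h" for h s
  proof -
    have "norm (LINT \<tau>|lborel. P (s, \<tau>) *v snd (h \<tau>)) \<le> indicator {a..b} s * (B * integral\<^sup>L lborel m)"
    proof (cases "s \<in> {a..b}")
      case True
      have "norm (LINT \<tau>|lborel. P (s, \<tau>) *v snd (h \<tau>)) \<le> (LINT \<tau>|lborel. B * m \<tau>)"
        using m by (intro order_trans[OF integral_norm_bound] integral_mono integrable_norm int h integrand_le) auto
      then show ?thesis using True by simp
    next
      case False
      then have "P (s, \<tau>) = 0" for \<tau> using support by auto
      then show ?thesis using False by simp
    qed
    moreover note dominated_components(3)[OF h, of s]
    ultimately show ?thesis
      unfolding memory_operator_def by (intro norm_triangle_le) simp
  qed
  show "memory_operator P (\<lambda>s. midpoint (g s) (h s)) = (\<lambda>s. midpoint (memory_operator P g s) (memory_operator P h s))"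
    if "dominated m g" "dominated m h" for g h
  proof
    fix s
    have "(LINT \<tau>|lborel. P (s, \<tau>) *v snd (midpoint (g \<tau>) (h \<tau>))) =
        (LINT \<tau>|lborel. inverse 2 *\<^sub>R (P (s, \<tau>) *v snd (g \<tau>) + P (s, \<tau>) *v snd (h \<tau>)))"
      by (simp add: midpoint_def matrix_vector_right_distrib matrix_vector_mult_scaleR)
    also have "\<dots> = midpoint (LINT \<tau>|lborel. P (s, \<tau>) *v snd (g \<tau>)) (LINT \<tau>|lborel. P (s, \<tau>) *v snd (h \<tau>))"
      using int[OF that(1)] int[OF that(2)] by (simp add: midpoint_def)
    finally show "memory_operator P (\<lambda>s. midpoint (g s) (h s)) s = midpoint (memory_operator P g s) (memory_operator P h s)"
      by (simp add: memory_operator_def midpoint_def scaleR_right_distrib)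
  qed
  show "memory_operator P g s = memory_operator P h s" if "\<And>\<tau>. \<tau> \<le> s \<Longrightarrow> g \<tau> = h \<tau>" for s g h
  proof -
    have "P (s, \<tau>) *v snd (g \<tau>) = P (s, \<tau>) *v snd (h \<tau>)" for \<tau>
      using that[of \<tau>] support[of \<tau> s] by (cases "\<tau> \<le> s") auto
    then show ?thesis using that[of s] by (simp add: memory_operator_def)
  qed
  show "AE s in lborel. (\<lambda>k. memory_operator P (u k) s) \<longlonglongrightarrow> memory_operator P h s"
    if u: "\<And>k. dominated m (u k)" and h: "dominated m h" and lim: "AE s in lborel. (\<lambda>k. u k s) \<longlonglongrightarrow> h s" for u h
    using lim
  proof eventually_elim
    case (elim s)
    have "(\<lambda>k. LINT \<tau>|lborel. P (s, \<tau>) *v snd (u k \<tau>)) \<longlonglongrightarrow> (LINT \<tau>|lborel. P (s, \<tau>) *v snd (h \<tau>))"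
    proof (rule integral_dominated_convergence[where w = "\<lambda>\<tau>. B * m \<tau>"])
      show "AE \<tau> in lborel. (\<lambda>k. P (s, \<tau>) *v snd (u k \<tau>)) \<longlonglongrightarrow> P (s, \<tau>) *v snd (h \<tau>)"
        using lim by eventually_elim
          (intro bounded_bilinear.tendsto[OF matrix_vector_mult_bounded_bilinear] tendsto_intros)
      show "AE \<tau> in lborel. norm (P (s, \<tau>) *v snd (u k \<tau>)) \<le> B * m \<tau>" for k
        using integrand_le[OF u] by auto
    qed (use m int[OF u] int[OF h] in \<open>auto dest: borel_measurable_integrable\<close>)
    then show ?case
      unfolding memory_operator_def using elim by (intro tendsto_intros)
  qed
qed


section \<open>Reduction to dominated Borel data\<close>

lemma lebesgue_measurable_borel_version:
  fixes g :: "'a::euclidean_space \<Rightarrow> 'b::euclidean_space"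
  assumes "g \<in> borel_measurable lebesgue"
  obtains g' where "g' \<in> borel_measurable borel" "AE x in lborel. g x = g' x"
proof -
  have "\<exists>u\<in>borel_measurable lborel. AE x in lborel. g x \<bullet> b = u x" for b
    using assms by (intro completion_ex_borel_measurable_real) simp
  then obtain u where u: "\<And>b. u b \<in> borel_measurable lborel" "\<And>b. AE x in lborel. g x \<bullet> b = u b x"
    by metis
  have [measurable]: "u b \<in> borel_measurable borel" for b using u(1)[of b] by simp
  show thesis
  proof
    show "(\<lambda>x. \<Sum>b\<in>Basis. u b x *\<^sub>R b) \<in> borel_measurable borel" by measurable
    have "AE x in lborel. \<forall>b\<in>Basis. g x \<bullet> b = u b x"
      by (intro AE_finite_allI u) auto
    then show "AE x in lborel. g x = (\<Sum>b\<in>Basis. u b x *\<^sub>R b)"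
    proof eventually_elim
      case (elim x)
      then have "(\<Sum>b\<in>Basis. u b x *\<^sub>R b) = (\<Sum>b\<in>Basis. (g x \<bullet> b) *\<^sub>R b)"
        by (intro sum.cong) auto
      then show ?case by (simp add: euclidean_representation)
    qed
  qed
qed

lemma AE_lborel_slices:
  fixes Q :: "'a::euclidean_space \<times> 'b::euclidean_space \<Rightarrow> bool"
  assumes "AE z in lborel. Q z"
  shows "AE x in lborel. AE y in lborel. Q (x, y)"
proof -
  have "pair_sigma_finite (lborel :: 'a measure) (lborel :: 'b measure)" ..
  from pair_sigma_finite.AE_pair[OF this, of Q] show ?thesis
    using assms unfolding lborel_prod by simp
qed

text \<open>
The regularization is local in space and blind to null sets: small radii already stay inside \<open>U\<close>.
\<close>

lemma filippov_reg_subset_AE: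
  assumes "open U" "x \<in> U" "AE y in lebesgue. y \<in> U \<longrightarrow> G (t, y) = g (t, y)"
  shows "filippov_reg G t x \<subseteq> filippov_reg g t x"
proof -
  obtain e where e: "0 < e" "ball x e \<subseteq> U"
    using assms(1,2) by (auto simp: open_contains_ball)
  have "filippov_reg G t x \<subseteq> ess_hull (\<lambda>y. g (t, y)) (ball x \<delta>)" if "0 < \<delta>" for \<delta>
  proof -
    have "filippov_reg G t x \<subseteq> ess_hull (\<lambda>y. G (t, y)) (ball x (min \<delta> e))"
      unfolding filippov_reg_eq_ess_hull using that e(1) by (intro INF_lower) auto
    also have "\<dots> \<subseteq> ess_hull (\<lambda>y. g (t, y)) (ball x (min \<delta> e))"
      by (rule ess_hull_subset_AE) (use assms(3) e(2) in \<open>auto elim!: eventually_mono\<close>)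
    also have "\<dots> \<subseteq> ess_hull (\<lambda>y. g (t, y)) (ball x \<delta>)"
      by (intro ess_hull_mono) auto
    finally show ?thesis .
  qed
  then show ?thesis
    unfolding filippov_reg_eq_ess_hull[of g] by blast
qed

text \<open>
Wherever the Borel version of \<open>g\<close> exceeds the bound of the Filippov condition, it is replaced by 0. By
Fubini, at almost every time this alters \<open>g\<close> only on a null set of points of the ball, which the
regularization there does not notice.
\<close>

lemma filippov_condition_truncation:
  fixes g :: "real \<times> (real^'n) \<Rightarrow> real^'n"
  assumes g: "filippov_condition g" and "0 < r"
  obtains G m where "G \<in> borel_measurable borel" "integrable lborel m" "\<And>t y. norm (G (t, y)) \<le> m t"
    "AE t in lborel. t \<in> {a..b} \<longrightarrow> (\<forall>x\<in>ball 0 r. filippov_reg G t x \<subseteq> filippov_reg g t x)"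
proof -
  \<comment> \<open>The added 1 puts the closed interval inside the open one of the Filippov condition.\<close>
  define \<alpha> where "\<alpha> = max \<bar>a\<bar> \<bar>b\<bar> + 1"
  have "0 < \<alpha>" unfolding \<alpha>_def by linarith
  then obtain m0 where m0: "set_integrable lebesgue {-\<alpha><..<\<alpha>} m0"
    and le: "AE t in lebesgue. t \<in> {-\<alpha><..<\<alpha>} \<longrightarrow> (AE x in lebesgue. x \<in> ball 0 r \<longrightarrow> norm (g (t, x)) \<le> m0 t)"
    using g \<open>0 < r\<close> unfolding filippov_condition_def by blast
  let ?m0 = "\<lambda>t. indicat_real {-\<alpha><..<\<alpha>} t * m0 t"
  have m0_int: "integrable lebesgue ?m0" using m0 by (simp add: set_integrable_def)
  obtain m1 where [measurable]: "m1 \<in> borel_measurable borel" and m1: "AE t in lborel. ?m0 t = m1 t"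
    using lebesgue_measurable_borel_version[OF borel_measurable_integrable[OF m0_int]] .
  define m where "m t = \<bar>m1 t\<bar>" for t
  have [measurable]: "m \<in> borel_measurable borel" unfolding m_def by measurable
  have "integrable lebesgue m1"
    using m1 by (intro integrable_cong_AE_imp[OF m0_int]) (auto simp: AE_completion_iff measurable_completion elim: eventually_mono)
  then have m_int: "integrable lborel m"
    unfolding m_def by (simp add: integrable_completion)
  obtain g1 where [measurable]: "g1 \<in> borel_measurable borel" and g1: "AE z in lborel. g z = g1 z"
    using g lebesgue_measurable_borel_version[of g] unfolding filippov_condition_def by blast
  define G where "G z = (if norm (g1 z) \<le> m (fst z) then g1 z else 0)" for z
  have [measurable]: "(\<lambda>z :: real \<times> (real^'n). m (fst z)) \<in> borel_measurable borel"
  proof -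
    have "(fst :: real \<times> (real^'n) \<Rightarrow> real) \<in> borel_measurable borel"
      by (intro borel_measurable_continuous_onI continuous_intros)
    then show ?thesis by measurable
  qed
  show thesis
  proof
    show "G \<in> borel_measurable borel" unfolding G_def by measurable
    show "integrable lborel m" by (rule m_int)
    show "norm (G (t, y)) \<le> m t" for t y by (simp add: G_def m_def)
    show "AE t in lborel. t \<in> {a..b} \<longrightarrow> (\<forall>x\<in>ball 0 r. filippov_reg G t x \<subseteq> filippov_reg g t x)"
      using AE_lborel_slices[OF g1] m1 le[unfolded AE_completion_iff]
    proof eventually_elim
      case (elim t)
      show ?case
      proof (intro impI ballI)
        fix x :: "real^'n" assume "t \<in> {a..b}" and x: "x \<in> ball 0 r"
        then have t: "t \<in> {-\<alpha><..<\<alpha>}" by (auto simp: \<alpha>_def)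
        then have "m0 t \<le> m t" using elim(2) by (simp add: m_def)
        have "AE y in lborel. norm (g (t, y)) \<le> m0 t \<or> y \<notin> ball 0 r"
          using elim(3) t by (auto elim: eventually_mono)
        with elim(1) have "AE y in lborel. y \<in> ball 0 r \<longrightarrow> G (t, y) = g (t, y)"
          by eventually_elim (use \<open>m0 t \<le> m t\<close> in \<open>auto simp: G_def\<close>)
        then show "filippov_reg G t x \<subseteq> filippov_reg g t x"
          by (intro filippov_reg_subset_AE[OF open_ball x]) (simp add: AE_completion_iff)
      qed
    qed
  qed
qed

text \<open>
The triangle of pairs \<open>(s, \<tau>)\<close> with \<open>a \<le> \<tau> \<le> s \<le> b\<close> is a compact part of \<open>Delta\<close>, so \<open>\<Phi>\<close> is essentially bounded
on it; outside it the solution on \<open>{a..b}\<close> does not see \<open>\<Phi>\<close>.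
\<close>

lemma kernel_truncation:
  fixes \<Phi> :: "real \<times> real \<Rightarrow> real^'n^'n"
  assumes \<Phi>: "\<Phi> \<in> borel_measurable (lebesgue_on Delta)" and bdd: "locally_ess_bounded_on Delta \<Phi>"
  obtains P B where "P \<in> borel_measurable borel" "0 \<le> B" "\<And>z u. norm (P z *v u) \<le> B * norm u"
    "\<And>s \<tau>. \<not> (a \<le> \<tau> \<and> \<tau> \<le> s \<and> s \<le> b) \<Longrightarrow> P (s, \<tau>) = 0"
    "AE s in lborel. s \<in> {a..b} \<longrightarrow> (AE \<tau> in lborel. \<tau> \<in> {a..s} \<longrightarrow> P (s, \<tau>) = \<Phi> (s, \<tau>))"
proof -
  define T where "T = {(s, \<tau>). a \<le> \<tau> \<and> \<tau> \<le> s \<and> s \<le> (b::real)}"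
  have below_diagonal: "closed {z :: real \<times> real. snd z \<le> fst z}"
    by (intro closed_Collect_le continuous_intros)
  have "T = cbox (a, a) (b, b) \<inter> {z. snd z \<le> fst z}"
    by (auto simp: T_def cbox_Pair_eq)
  then have T: "compact T" using below_diagonal by (simp add: compact_Int_closed)
  have D_closed: "closed Delta"
    using below_diagonal by (simp add: Delta_def case_prod_unfold)
  have "T \<subseteq> Delta" by (auto simp: T_def Delta_def)
  have T_sets [measurable]: "T \<in> sets borel" using T by (simp add: borel_compact)
  define E where "E = esssup (lebesgue_on T) (\<lambda>z. ereal (norm (\<Phi> z)))"
  have "E < \<infinity>"
    using bdd T \<open>T \<subseteq> Delta\<close> unfolding locally_ess_bounded_on_def E_def by blast
  then obtain c :: real where c: "E \<le> ereal c"
    by (cases E) auto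
  have "AE z in lebesgue_on T. ereal (norm (\<Phi> z)) \<le> E"
    unfolding E_def by (rule esssup_AE)
  then have \<Phi>_le: "AE z in lborel. z \<in> T \<longrightarrow> norm (\<Phi> z) \<le> c"
    using T_sets c by (subst (asm) AE_restrict_space_iff) (auto simp: AE_completion_iff elim!: eventually_mono dest: order_trans)
  have "(\<lambda>z. if z \<in> Delta then \<Phi> z else 0) \<in> borel_measurable lebesgue"
    using \<Phi> D_closed by (intro borel_measurable_if_I) auto
  then obtain \<Phi>1 where [measurable]: "\<Phi>1 \<in> borel_measurable borel"
    and \<Phi>1: "AE z in lborel. (if z \<in> Delta then \<Phi> z else 0) = \<Phi>1 z"
    by (rule lebesgue_measurable_borel_version)
  define P where "P z = (if z \<in> T \<and> norm (\<Phi>1 z) \<le> c then \<Phi>1 z else 0)" for z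
  obtain K where K: "0 < K" "\<And>(A :: real^'n^'n) u. norm (A *v u) \<le> norm A * norm u * K"
    using bounded_bilinear.pos_bounded[OF matrix_vector_mult_bounded_bilinear[where 'n='n and 'm='n]] by auto
  show thesis
  proof
    show "P \<in> borel_measurable borel" unfolding P_def by measurable
    show "0 \<le> \<bar>c\<bar> * K" using K by simp
    show "norm (P z *v u) \<le> \<bar>c\<bar> * K * norm u" for z u
    proof -
      have "norm (P z) \<le> \<bar>c\<bar>" by (auto simp: P_def)
      then have "norm (P z) * (norm u * K) \<le> \<bar>c\<bar> * (norm u * K)"
        using K(1) by (intro mult_right_mono) auto
      then show ?thesis using K(2)[of "P z" u] by (simp add: mult_ac)
    qed
    show "P (s, \<tau>) = 0" if "\<not> (a \<le> \<tau> \<and> \<tau> \<le> s \<and> s \<le> b)" for s \<tau>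
      using that by (auto simp: P_def T_def)
    have "AE z in lborel. z \<in> T \<longrightarrow> P z = \<Phi> z"
      using \<Phi>_le \<Phi>1 by eventually_elim (use \<open>T \<subseteq> Delta\<close> in \<open>auto simp: P_def\<close>)
    then show "AE s in lborel. s \<in> {a..b} \<longrightarrow> (AE \<tau> in lborel. \<tau> \<in> {a..s} \<longrightarrow> P (s, \<tau>) = \<Phi> (s, \<tau>))"
      by (rule AE_lborel_slices[THEN eventually_mono]) (auto simp: T_def elim!: eventually_mono)
  qed
qed


section \<open>Local existence of Filippov solutions\<close>

text \<open>
The selection behind the Aumann integral is formed with the original kernel. It agrees almost
everywhere with the Borel integrand, from which it inherits measurability and the integral, since
Lebesgue measure is complete.
\<close>

lemma aumann_integral_memory:
  fixes \<Phi> :: "real \<times> real \<Rightarrow> real^'n^'n"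
  assumes q: "integrable lborel (\<lambda>\<tau>. P \<tau> *v v \<tau>)"
    and support: "\<And>\<tau>. \<tau> \<notin> {a..t} \<Longrightarrow> P \<tau> = 0"
    and eq: "AE \<tau> in lborel. \<tau> \<in> {a..t} \<longrightarrow> P \<tau> = \<Phi> (t, \<tau>)"
    and sel: "AE \<tau> in lborel. \<tau> \<in> {a..t} \<longrightarrow> v \<tau> \<in> F \<tau>"
  shows "(LINT \<tau>|lborel. P \<tau> *v v \<tau>) \<in> aumann_integral a t (\<lambda>\<tau>. (\<lambda>u. \<Phi> (t, \<tau>) *v u) ` F \<tau>)"
proof -
  let ?q = "\<lambda>\<tau>. P \<tau> *v v \<tau>" and ?w = "\<lambda>\<tau>. \<Phi> (t, \<tau>) *v v \<tau>"
  have ae: "AE \<tau> in lebesgue. ?q \<tau> = indicat_real {a..t} \<tau> *\<^sub>R ?w \<tau>"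
    unfolding AE_completion_iff using eq by eventually_elim (use support in \<open>auto simp: indicator_def\<close>)
  have q_meas: "?q \<in> borel_measurable lborel" using q by auto
  have q_int: "integrable lebesgue ?q" using q q_meas by (simp add: integrable_completion)
  have w_meas: "(\<lambda>\<tau>. indicat_real {a..t} \<tau> *\<^sub>R ?w \<tau>) \<in> borel_measurable lebesgue"
    by (rule borel_measurable_AE[OF borel_measurable_integrable[OF q_int] ae])
  have "set_integrable lebesgue {a..t} ?w"
    unfolding set_integrable_def using integrable_cong_AE_imp[OF q_int w_meas] ae by (auto elim: eventually_mono)
  moreover have "set_lebesgue_integral lebesgue {a..t} ?w = (LINT \<tau>|lborel. P \<tau> *v v \<tau>)"
    unfolding set_lebesgue_integral_def integral_completion[OF q_meas, symmetric]
    by (rule integral_cong_AE[OF w_meas]) (use q_int ae in \<open>auto elim: eventually_mono\<close>)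
  moreover have "AE \<tau> in lebesgue. \<tau> \<in> {a..t} \<longrightarrow> ?w \<tau> \<in> (\<lambda>u. \<Phi> (t, \<tau>) *v u) ` F \<tau>"
    unfolding AE_completion_iff using sel by eventually_elim auto
  ultimately show ?thesis
    unfolding aumann_integral_def by (auto intro!: exI[of _ ?w])
qed

theorem theorem14:
  fixes \<Phi> :: "real \<times> real \<Rightarrow> real^'n^'n"
    and f f' :: "real \<times> (real^'n) \<Rightarrow> real^'n"
    and t0 :: real and x0 :: "real^'n"
  assumes "\<Phi> \<in> borel_measurable (lebesgue_on Delta)"
    and "locally_ess_bounded_on Delta \<Phi>"
    and "filippov_condition f"
    and "filippov_condition f'"
  shows "\<exists>\<alpha>>0. \<exists>x. filippov_solution \<Phi> f f' t0 x0 {t0..<t0 + \<alpha>} x"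
proof -
  define T r where "T = t0 + 1" and "r = norm x0 + 1"
  have "0 < r" by (auto simp: r_def intro: add_nonneg_pos)
  obtain F m\<^sub>F where F: "F \<in> borel_measurable borel" "integrable lborel m\<^sub>F" "\<And>t y. norm (F (t, y)) \<le> m\<^sub>F t"
    "AE t in lborel. t \<in> {t0..T} \<longrightarrow> (\<forall>x\<in>ball 0 r. filippov_reg F t x \<subseteq> filippov_reg f t x)"
    using filippov_condition_truncation[OF assms(3) \<open>0 < r\<close>, of t0 T] by blast
  obtain G m\<^sub>G where G: "G \<in> borel_measurable borel" "integrable lborel m\<^sub>G" "\<And>t y. norm (G (t, y)) \<le> m\<^sub>G t"
    "AE t in lborel. t \<in> {t0..T} \<longrightarrow> (\<forall>x\<in>ball 0 r. filippov_reg G t x \<subseteq> filippov_reg f' t x)"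
    using filippov_condition_truncation[OF assms(4) \<open>0 < r\<close>, of t0 T] by blast
  obtain P B where P: "P \<in> borel_measurable borel" "0 \<le> B" "\<And>z u. norm (P z *v u) \<le> B * norm u"
    "\<And>s \<tau>. \<not> (t0 \<le> \<tau> \<and> \<tau> \<le> s \<and> s \<le> T) \<Longrightarrow> P (s, \<tau>) = 0"
    and P_eq: "AE s in lborel. s \<in> {t0..T} \<longrightarrow> (AE \<tau> in lborel. \<tau> \<in> {t0..s} \<longrightarrow> P (s, \<tau>) = \<Phi> (s, \<tau>))"
    using kernel_truncation[OF assms(1,2), of t0 T] by blast
  define H where "H z = (F z, G z)" for z
  define m where "m t = m\<^sub>F t + m\<^sub>G t" for t
  have H: "H \<in> borel_measurable borel"
    unfolding H_def using F(1) G(1) by (intro borel_measurable_Pair)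
  have H_bound: "norm (H (t, y)) \<le> m t" for t y
    unfolding H_def m_def using norm_Pair_le[of "F (t, y)" "G (t, y)"] F(3)[of t y] G(3)[of t y] by linarith
  have m: "integrable lborel m" unfolding m_def using F(2) G(2) by simp
  interpret volterra_operator "memory_operator P" m "\<lambda>s. m s + indicator {t0..T} s * (B * integral\<^sup>L lborel m)"
    using volterra_memory_operator[OF P m] .
  obtain h where h: "dominated m h" and sel: "AE s in lborel. s \<in> {t0..T} \<longrightarrow>
      h s \<in> (\<Inter>\<delta>\<in>{0<..}. ess_hull (\<lambda>y. H (s, y)) (ball (primitive_from t0 x0 (memory_operator P h) s) \<delta>))"
    using inclusion_solution[OF H H_bound, of t0 T x0] by blast
  define x where "x = primitive_from t0 x0 (memory_operator P h)"
  have w: "integrable lborel (memory_operator P h)" by (rule S_integrable[OF h])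
  have x_t0: "x t0 = x0" unfolding x_def by (rule primitive_from_initial[OF w order_refl])
  have reg: "AE s in lborel. s \<in> {t0..T} \<longrightarrow> fst (h s) \<in> filippov_reg F s (x s) \<and> snd (h s) \<in> filippov_reg G s (x s)"
    using sel
  proof eventually_elim
    case (elim s)
    then show ?case
      using bounded_linear_image_ess_hull[OF bounded_linear_fst, of "\<lambda>y. H (s, y)"]
        bounded_linear_image_ess_hull[OF bounded_linear_snd, of "\<lambda>y. H (s, y)"]
      unfolding filippov_reg_eq_ess_hull x_def[symmetric] by (fastforce simp: H_def)
  qed
  have "continuous_on {t0..T} x" unfolding x_def by (rule continuous_on_primitive_from[OF w])
  then obtain d where d: "0 < d" "\<And>t. t \<in> {t0..T} \<Longrightarrow> dist t t0 < d \<Longrightarrow> dist (x t) (x t0) < 1"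
    unfolding continuous_on_iff by (elim ballE[of _ _ t0] allE[of _ 1]) (auto simp: T_def)
  \<comment> \<open>Up to time \<open>t0 + \<alpha>\<close> the trajectory stays in the ball on which the truncations are harmless.\<close>
  define \<alpha> where "\<alpha> = min d 1"
  let ?I = "{t0..<t0 + \<alpha>}"
  have I: "t \<in> {t0..T}" "x t \<in> ball 0 r" if "t \<in> ?I" for t
  proof -
    show t: "t \<in> {t0..T}" using that by (auto simp: \<alpha>_def T_def)
    then have "dist (x t) x0 < 1" using that d(2)[of t] x_t0 by (auto simp: \<alpha>_def dist_real_def)
    then show "x t \<in> ball 0 r"
      using norm_triangle_ineq2[of "x t" x0] by (simp add: r_def dist_norm)
  qed
  have sel_f': "AE \<tau> in lborel. \<tau> \<in> ?I \<longrightarrow> snd (h \<tau>) \<in> filippov_reg f' \<tau> (x \<tau>)"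
    using reg G(4) by eventually_elim (use I in blast)
  have "AE t in lborel. t \<in> ?I \<longrightarrow> (\<exists>v. (x has_vector_derivative v) (at t within ?I) \<and>
      v \<in> filippov_reg f t (x t) +
           aumann_integral t0 t (\<lambda>\<tau>. (\<lambda>u. \<Phi> (t, \<tau>) *v u) ` filippov_reg f' \<tau> (x \<tau>)))"
    using AE_indefinite_integral_has_derivative[OF w, of t0, unfolded AE_completion_iff] AE_lborel_singleton[of t0]
      P_eq reg F(4)
  proof eventually_elim
    case (elim t)
    show ?case
    proof
      assume t: "t \<in> ?I"
      with elim(1,2) have "((\<lambda>t. LINT s:{t0..t}|lborel. memory_operator P h s) has_vector_derivative memory_operator P h t) (at t)"
        by auto
      \<comment> \<open>The summand 0 is the derivative of the constant \<open>x0\<close>.\<close>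
      then have "(x has_vector_derivative 0 + memory_operator P h t) (at t)"
        unfolding x_def primitive_from_def by (intro has_vector_derivative_add) auto
      then have "(x has_vector_derivative memory_operator P h t) (at t within ?I)"
        by (simp add: has_vector_derivative_at_within)
      moreover have "fst (h t) \<in> filippov_reg f t (x t)"
        using elim(4,5) I[OF t] by blast
      moreover have "(LINT \<tau>|lborel. P (t, \<tau>) *v snd (h \<tau>))
          \<in> aumann_integral t0 t (\<lambda>\<tau>. (\<lambda>u. \<Phi> (t, \<tau>) *v u) ` filippov_reg f' \<tau> (x \<tau>))"
      proof (rule aumann_integral_memory)
        show "integrable lborel (\<lambda>\<tau>. P (t, \<tau>) *v snd (h \<tau>))"
          by (rule memory_integrand(2)[OF P(1-3) m h])
        show "P (t, \<tau>) = 0" if "\<tau> \<notin> {t0..t}" for \<tau> using P(4) that by auto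
        show "AE \<tau> in lborel. \<tau> \<in> {t0..t} \<longrightarrow> P (t, \<tau>) = \<Phi> (t, \<tau>)"
          using elim(3) I[OF t] by blast
        show "AE \<tau> in lborel. \<tau> \<in> {t0..t} \<longrightarrow> snd (h \<tau>) \<in> filippov_reg f' \<tau> (x \<tau>)"
          using sel_f' by eventually_elim (use t in auto)
      qed
      ultimately show "\<exists>v. (x has_vector_derivative v) (at t within ?I) \<and>
          v \<in> filippov_reg f t (x t) +
               aumann_integral t0 t (\<lambda>\<tau>. (\<lambda>u. \<Phi> (t, \<tau>) *v u) ` filippov_reg f' \<tau> (x \<tau>))"
        unfolding memory_operator_def by (blast intro: set_plus_intro)
    qed
  qed
  then have "filippov_solution \<Phi> f f' t0 x0 ?I x"
    unfolding filippov_solution_def AE_completion_iff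
    using abs_continuous_on_primitive_from[OF w] x_t0 by (auto simp: x_def)
  moreover have "0 < \<alpha>" using d(1) by (simp add: \<alpha>_def)
  ultimately show ?thesis by blast
qed

end
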